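(* Let $d\ge2$, $\varrho>0$ and $w_0(t)=|t|(t^2-\varrho^2)^{-\frac12}e^{-t^2}$ for $|t|\ge\varrho$. For $n=0,1,2,\ldots$, every $u\in\mathcal V_n^E(\mathbb V_0^{d+1},w_0)$ satisfies $$\Big[\Big(1-\frac{\varrho^2}{t^2}\Big)\partial_t^2+\Big(\frac{\varrho^2}{t^2}-2(t^2-\varrho^2)\Big)\frac1t\partial_t+\frac{d-1}t\partial_t+\frac1{t^2-\varrho^2}\Delta_0^{(x)}\Big]u=-2n\,u .$$
   Context: $\mathbb V_0^{d+1}=\{(x,t)\in\mathbb R^d\times\mathbb R:\ \|x\|^2=t^2-\varrho^2,\ |t|\ge\varrho\}$ is the infinite double hyperboloid. Integration over it means $\int f\,d\sigma=\int_{|t|\ge\varrho}(t^2-\varrho^2)^{\frac{d-1}2}\int_{\mathbb S^{d-1}}f(\sqrt{t^2-\varrho^2}\,\xi,t)\,d\sigma(\xi)\,dt$. $\mathcal V_n^E(\mathbb V_0^{d+1},w)$ is the space of restrictions to $\mathbb V_0^{d+1}$ of polynomials in $(x,t)$ of degree at most $n$ that are even in $t$ ($u(x,-t)=u(x,t)$) and orthogonal to all polynomials of degree at most $n-1$ with respect to $\langle f,g\rangle_w=\int_{\mathbb V_0^{d+1}}f\,g\,w(t)\,d\sigma(x,t)$. The operators are understood in the coordinates $(\xi,t)$, $x=\sqrt{t^2-\varrho^2}\,\xi$, $\xi\in\mathbb S^{d-1}$, $|t|>\varrho$: $\partial_t$ is the derivative in $t$ with $\xi$ fixed, and $\Delta_0^{(x)}$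 is the Laplace–Beltrami operator of $\mathbb S^{d-1}$ acting on $\xi$. *)

theory Defs
  imports "HOL-Analysis.Analysis"
begin

definition double_hyperboloid :: "real \<Rightarrow> ((real ^ 'd) \<times> real) set" where
  "double_hyperboloid \<rho> = {(x, t). (norm x)\<^sup>2 = t\<^sup>2 - \<rho>\<^sup>2 \<and> \<bar>t\<bar> \<ge> \<rho>}"

text \<open>The (unnormalised) surface measure on the unit sphere, obtained from Lebesgue measure as in
  polar coordinates: \<open>\<sigma>(A) = d \<cdot> vol {r \<xi> | 0 < r \<le> 1, \<xi> \<in> A}\<close>.\<close>

definition sphere_measure :: "(real ^ 'd) measure" where
  "sphere_measure =
     scale_measure (of_nat CARD('d))
       (distr (restrict_space lborel (cball 0 1 - {0})) (restrict_space borel (sphere 0 1))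
          (\<lambda>x. x /\<^sub>R norm x))"

lemma emeasure_sphere_measure:
  fixes A :: "(real ^ 'd) set"
  assumes "A \<in> sets borel" "A \<subseteq> sphere 0 1"
  shows "emeasure sphere_measure A =
    of_nat CARD('d) * emeasure lborel {r *\<^sub>R \<xi> | r \<xi>. 0 < r \<and> r \<le> 1 \<and> \<xi> \<in> A}"
proof -
  let ?M = "restrict_space lborel (cball 0 1 - {0::real ^ 'd})"
  let ?N = "restrict_space borel (sphere 0 (1::real) :: (real ^ 'd) set)"
  let ?p = "\<lambda>x::real ^ 'd. x /\<^sub>R norm x"
  have "?p \<in> measurable ?M borel"
    by (rule measurable_restrict_space1) simp
  then have p: "?p \<in> measurable ?M ?N"
    by (intro measurable_restrict_space2) (auto simp: space_restrict_space)
  have A: "A \<in> sets ?N"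
    using assms by (auto simp: sets_restrict_space)
  have eq: "?p -` A \<inter> space ?M = {r *\<^sub>R \<xi> | r \<xi>. 0 < r \<and> r \<le> 1 \<and> \<xi> \<in> A}" (is "?L = ?R")
  proof (intro subset_antisym subsetI)
    fix x assume "x \<in> ?L"
    then have "x = norm x *\<^sub>R ?p x" "0 < norm x" "norm x \<le> 1" "?p x \<in> A"
      by (auto simp: space_restrict_space)
    then show "x \<in> ?R" by blast
  next
    fix x assume "x \<in> ?R"
    then obtain r \<xi> where x: "x = r *\<^sub>R \<xi>" "0 < r" "r \<le> 1" "\<xi> \<in> A" by blast
    moreover have "norm \<xi> = 1" using x assms by auto
    ultimately show "x \<in> ?L" by (auto simp: space_restrict_space)
  qed
  have "emeasure (distr ?M ?N ?p) A = emeasure ?M ?R"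
    using emeasure_distr[OF p A] eq by simp
  also have "\<dots> = emeasure lborel ?R"
    by (rule emeasure_restrict_space)
       (auto simp: eq[symmetric] space_restrict_space simp del: sets_lborel)
  finally show ?thesis
    by (simp add: sphere_measure_def)
qed

definition hyperboloid_integral :: "real \<Rightarrow> ((real ^ 'd) \<times> real \<Rightarrow> real) \<Rightarrow> real" where
  "hyperboloid_integral \<rho> f =
     (LINT t:{t. \<bar>t\<bar> \<ge> \<rho>}|lborel. (t\<^sup>2 - \<rho>\<^sup>2) powr ((real CARD('d) - 1) / 2) *
        (LINT \<xi>|sphere_measure. f (sqrt (t\<^sup>2 - \<rho>\<^sup>2) *\<^sub>R \<xi>, t)))"

definition hyperboloid_inner ::
  "real \<Rightarrow> (real \<Rightarrow> real) \<Rightarrow> ((real ^ 'd) \<times> real \<Rightarrow> real) \<Rightarrow> ((real ^ 'd) \<times> real \<Rightarrow> real) \<Rightarrow> real" where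
  "hyperboloid_inner \<rho> w f g = hyperboloid_integral \<rho> (\<lambda>(x, t). f (x, t) * g (x, t) * w t)"

definition polys_deg_le :: "nat \<Rightarrow> ((real ^ 'd) \<times> real \<Rightarrow> real) set" where
  "polys_deg_le n =
     {p. \<exists>c :: ('d \<Rightarrow> nat) \<Rightarrow> nat \<Rightarrow> real.
        p = (\<lambda>(x, t). \<Sum>(\<alpha>, k) \<in> {(\<alpha>, k). (\<Sum>i\<in>UNIV. \<alpha> i) + k \<le> n}.
               c \<alpha> k * (\<Prod>i\<in>UNIV. (x $ i) ^ \<alpha> i) * t ^ k)}"

lemma finite_exponents:
  "finite {(\<alpha> :: 'd::finite \<Rightarrow> nat, k :: nat). (\<Sum>i\<in>UNIV. \<alpha> i) + k \<le> n}"
proof (rule finite_subset)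
  show "{(\<alpha> :: 'd \<Rightarrow> nat, k). (\<Sum>i\<in>UNIV. \<alpha> i) + k \<le> n} \<subseteq> PiE UNIV (\<lambda>_. {..n}) \<times> {..n}"
  proof -
    have "\<alpha> i \<le> n" if "sum \<alpha> UNIV + k \<le> n" for \<alpha> :: "'d \<Rightarrow> nat" and k i
      using member_le_sum[of i UNIV \<alpha>] that by simp
    then show ?thesis by (auto simp: PiE_def extensional_def)
  qed
  show "finite (PiE (UNIV :: 'd set) (\<lambda>_. {..n}) \<times> {..n})"
    by (rule finite_cartesian_product) (auto intro: finite_PiE)
qed

text \<open>Orthogonality to degree \<open>\<le> n - 1\<close> is expressed by all degrees \<open>m < n\<close>, so that it
  is vacuous for \<open>n = 0\<close>.\<close>

definition even_ortho_polys ::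
  "real \<Rightarrow> (real \<Rightarrow> real) \<Rightarrow> nat \<Rightarrow> ((real ^ 'd) \<times> real \<Rightarrow> real) set" where
  "even_ortho_polys \<rho> w n =
     {restrict p (double_hyperboloid \<rho>) | p.
        p \<in> polys_deg_le n \<and> (\<forall>x t. p (x, - t) = p (x, t)) \<and>
        (\<forall>m<n. \<forall>q\<in>polys_deg_le m. hyperboloid_inner \<rho> w p q = 0)}"

definition w0 :: "real \<Rightarrow> real \<Rightarrow> real" where
  "w0 \<rho> t = \<bar>t\<bar> * (t\<^sup>2 - \<rho>\<^sup>2) powr (- 1 / 2) * exp (- (t\<^sup>2))"

definition laplacian :: "(real ^ 'd \<Rightarrow> real) \<Rightarrow> real ^ 'd \<Rightarrow> real" where
  "laplacian F x = (\<Sum>i\<in>UNIV. (deriv ^^ 2) (\<lambda>s. F (x + s *\<^sub>R axis i 1)) 0)"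

text \<open>The Laplace--Beltrami operator of the unit sphere: the Euclidean Laplacian of the extension
  that is constant along rays.\<close>

definition sphere_laplacian :: "(real ^ 'd \<Rightarrow> real) \<Rightarrow> real ^ 'd \<Rightarrow> real" where
  "sphere_laplacian f \<xi> = laplacian (\<lambda>y. f (y /\<^sub>R norm y)) \<xi>"

definition hyperboloid_coords ::
  "real \<Rightarrow> ((real ^ 'd) \<times> real \<Rightarrow> real) \<Rightarrow> real ^ 'd \<Rightarrow> real \<Rightarrow> real" where
  "hyperboloid_coords \<rho> u \<xi> t = u (sqrt (t\<^sup>2 - \<rho>\<^sup>2) *\<^sub>R \<xi>, t)"

definition hyperboloid_operator ::
  "real \<Rightarrow> ((real ^ 'd) \<times> real \<Rightarrow> real) \<Rightarrow> real ^ 'd \<Rightarrow> real \<Rightarrow> real" where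
  "hyperboloid_operator \<rho> u \<xi> t = (let U = hyperboloid_coords \<rho> u in
     (1 - \<rho>\<^sup>2 / t\<^sup>2) * (deriv ^^ 2) (U \<xi>) t
     + (\<rho>\<^sup>2 / t\<^sup>2 - 2 * (t\<^sup>2 - \<rho>\<^sup>2)) * (1 / t) * deriv (U \<xi>) t
     + (real CARD('d) - 1) / t * deriv (U \<xi>) t
     + 1 / (t\<^sup>2 - \<rho>\<^sup>2) * sphere_laplacian (\<lambda>\<eta>. U \<eta> t) \<xi>)"

end

theory Submission
  imports Defs "HOL-Probability.Distributions"
begin

text \<open>On the hyperboloid \<open>t\<^sup>2 = |x|\<^sup>2 + \<rho>\<^sup>2\<close>, so a polynomial that is even in \<open>t\<close> restricts to a
  polynomial \<open>P\<close> in \<open>x\<close> alone. With \<open>r\<^sup>2 = t\<^sup>2 - \<rho>\<^sup>2\<close> the weight \<open>w\<^sub>0\<close> turns the inner product into a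
  multiple of \<open>\<integral> P Q exp (- |x|\<^sup>2) dx\<close> over \<open>\<real>\<^sup>d\<close>, and the differential operator into
  \<open>\<Delta> - 2 x \<cdot> \<nabla>\<close>. The latter is symmetric for the Gaussian weight and acts on the
  homogeneous part of degree \<open>n\<close> as \<open>- 2 n\<close> up to lower degree. Hence \<open>R = (\<Delta> - 2 x \<cdot> \<nabla> + 2 n) P\<close> has
  degree less than \<open>n\<close> and is orthogonal to all polynomials of degree less than \<open>n\<close>, in particular to itself,
  so \<open>R = 0\<close>.\<close>

section \<open>Polar and hyperboloid coordinates\<close>

text \<open>For r = sqrt (t^2 - \<rho>^2) one has dr = (t / r) dt, so the factor |t| (t^2 -
  \<rho>^2)^(-1/2) of the weight is exactly the Jacobian of the radial variable. Since exp (- t^2) =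
  exp (- \<rho>^2) exp (- |x|^2) and there are two sheets, the multiple in question is 2 exp (-
  \<rho>^2). The same substitution turns (1 - \<rho>^2/t^2) d^2/dt^2 into d^2/dr^2 - \<rho>^2/(r
  t^2) d/dr, and the term (\<rho>^2/t^3) d/dt of the operator cancels this correction; what remains
  is the polar form of the Laplacian minus 2 r d/dr. The identity is checked on monomials instead of
  by a chain rule. Symmetry needs no integration by parts over several variables: monomials and the
  Gaussian factor over the coordinates, which leaves the recurrence 2 m(k+2) = (k+1) m(k) of the
  one-dimensional moments. Evenness matters because t^k = (|x|^2 + \<rho>^2)^(k/2) is, for even k, a
  polynomial in x of the same degree k, so eliminating t does not raise the degree.\<close>

lemma hyperboloid_coordinate_change:
  fixes f :: "real \<Rightarrow> real"
  assumes \<rho>: "\<rho> > 0" and f: "set_integrable lborel {0<..} f" and [measurable]: "f \<in> borel_measurable borel"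
  shows "has_bochner_integral lborel
    (\<lambda>t. indicator {t. \<bar>t\<bar> \<ge> \<rho>} t * (\<bar>t\<bar> / sqrt (t\<^sup>2 - \<rho>\<^sup>2) * f (sqrt (t\<^sup>2 - \<rho>\<^sup>2))))
    (2 * (LINT r:{0<..}|lborel. f r))"
proof -
  define g where "g t = sqrt (t\<^sup>2 - \<rho>\<^sup>2)" for t
  define K where "K t = \<bar>t\<bar> / g t * f (g t)" for t
  have [measurable]: "g \<in> borel_measurable borel" "K \<in> borel_measurable borel"
    unfolding g_def[abs_def] K_def[abs_def] by measurable
  have pos: "t\<^sup>2 - \<rho>\<^sup>2 > 0" if "t > \<rho>" for t
    using power_strict_mono[OF that, of 2] \<rho> by simp
  have der: "(g has_field_derivative t / g t) (at t within {\<rho><..})" if "t \<in> {\<rho><..}" for t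
    unfolding g_def using pos[of t] that
    by (auto intro!: derivative_eq_intros simp: field_simps)
  have inj: "inj_on g {\<rho><..}"
  proof (rule inj_onI)
    fix s t assume st: "s \<in> {\<rho><..}" "t \<in> {\<rho><..}" "g s = g t"
    then have "s\<^sup>2 = t\<^sup>2" by (simp add: g_def)
    then show "s = t" using st \<rho> by (simp add: power2_eq_iff_nonneg)
  qed
  have im: "g ` {\<rho><..} = {0<..}"
  proof (intro subset_antisym subsetI)
    fix r assume "r \<in> g ` {\<rho><..}"
    then show "r \<in> {0<..}" using pos by (auto simp: g_def)
  next
    fix r :: real assume r: "r \<in> {0<..}"
    have "g (sqrt (r\<^sup>2 + \<rho>\<^sup>2)) = r" using r by (simp add: g_def)
    moreover have "sqrt (r\<^sup>2 + \<rho>\<^sup>2) > \<rho>"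
      using r \<rho> by (intro real_less_rsqrt) simp
    ultimately show "r \<in> g ` {\<rho><..}"
      by (intro image_eqI[where x = "sqrt (r\<^sup>2 + \<rho>\<^sup>2)"]) auto
  qed
  \<comment> \<open>The change of variables theorem concerns Lebesgue measure; Borel measurability
    allows passing to the completion here and back to \<open>lborel\<close> below.\<close>
  have f': "f absolutely_integrable_on {0<..}"
    using f unfolding set_integrable_def by (subst integrable_completion) auto
  have "(\<lambda>t. \<bar>t / g t\<bar> * f (g t)) absolutely_integrable_on {\<rho><..} \<and>
      integral {\<rho><..} (\<lambda>t. \<bar>t / g t\<bar> * f (g t)) = integral {0<..} f"
    using has_absolute_integral_change_of_variables_1'[OF _ der inj, of f "integral {0<..} f"] f'
    by (simp add: im)
  moreover have eq: "\<bar>t / g t\<bar> * f (g t) = K t" if "t \<in> {\<rho><..}" for t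
    using pos[of t] that \<rho> by (simp add: K_def g_def abs_divide)
  have "(\<lambda>t. \<bar>t / g t\<bar> * f (g t)) absolutely_integrable_on {\<rho><..} \<longleftrightarrow> K absolutely_integrable_on {\<rho><..}"
    by (rule set_integrable_cong) (simp_all only: eq)
  moreover have "integral {\<rho><..} (\<lambda>t. \<bar>t / g t\<bar> * f (g t)) = integral {\<rho><..} K"
    by (rule Henstock_Kurzweil_Integration.integral_cong) (rule eq)
  ultimately have KL: "K absolutely_integrable_on {\<rho><..}"
    and KI: "integral {\<rho><..} K = integral {0<..} f"
    by simp_all
  have K: "set_integrable lborel {\<rho><..} K"
    using KL unfolding set_integrable_def by (subst (asm) integrable_completion) auto
  have Kf: "(LINT t:{\<rho><..}|lborel. K t) = (LINT r:{0<..}|lborel. f r)"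
    using set_borel_integral_eq_integral(2)[OF K] set_borel_integral_eq_integral(2)[OF f] KI by simp
  let ?K = "\<lambda>t. indicator {t. \<bar>t\<bar> \<ge> \<rho>} t * K t"
  have "has_bochner_integral lborel (\<lambda>t. indicator {\<rho><..} t *\<^sub>R K t) (LINT r:{0<..}|lborel. f r)"
    using K Kf by (simp add: has_bochner_integral_iff set_integrable_def set_lebesgue_integral_def)
  \<comment> \<open>Rewrites the upper sheet as the half-line part of the even function
    \<open>?K\<close>, so that evenness supplies the lower sheet and the factor 2.\<close>
  moreover have "AE t in lborel. indicator {\<rho><..} t *\<^sub>R K t = indicator {0..} t *\<^sub>R ?K t"
    by (rule eventually_mono[OF AE_lborel_singleton[of \<rho>]]) (use \<rho> in \<open>auto simp: indicator_def\<close>)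
  ultimately have "has_bochner_integral lborel (\<lambda>t. indicator {0..} t *\<^sub>R ?K t) (LINT r:{0<..}|lborel. f r)"
    by (subst (asm) has_bochner_integral_cong_AE) simp_all
  then have "has_bochner_integral lborel ?K (2 *\<^sub>R (LINT r:{0<..}|lborel. f r))"
    by (rule has_bochner_integral_even_function) (simp add: K_def g_def indicator_def)
  then show ?thesis by (simp add: K_def g_def)
qed

section \<open>Polar coordinates for the cone-based sphere measure\<close>

lemma space_sphere_measure: "space (sphere_measure :: (real ^ 'd::finite) measure) = sphere 0 1"
  by (simp add: sphere_measure_def space_scale_measure space_restrict_space)

lemma sets_sphere_measure [measurable_cong]:
  "sets (sphere_measure :: (real ^ 'd::finite) measure) = sets (restrict_space borel (sphere 0 1))"
  by (simp add: sphere_measure_def)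

text \<open>The radius \<open>R\<close> is a parameter because R = 1 recovers the set that defines
  \<open>sphere_measure\<close>, while varying \<open>R\<close> gives the distribution function of
  the norm on the cone over \<open>B\<close>.\<close>

definition unit_cone :: "(real ^ 'd::finite) set \<Rightarrow> real \<Rightarrow> (real ^ 'd) set" where
  "unit_cone B R = {x. x \<noteq> 0 \<and> norm x \<le> R \<and> x /\<^sub>R norm x \<in> B}"

lemma unit_cone_1:
  assumes "B \<subseteq> sphere 0 1"
  shows "unit_cone B 1 = {r *\<^sub>R \<xi> | r \<xi>. 0 < r \<and> r \<le> 1 \<and> \<xi> \<in> B}" (is "_ = ?R")
proof (intro subset_antisym subsetI)
  fix x assume "x \<in> unit_cone B 1"
  then have "x = norm x *\<^sub>R (x /\<^sub>R norm x)" "0 < norm x" "norm x \<le> 1" "x /\<^sub>R norm x \<in> B"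
    by (auto simp: unit_cone_def)
  then show "x \<in> ?R" by blast
next
  fix x assume "x \<in> ?R"
  then obtain r \<xi> where x: "x = r *\<^sub>R \<xi>" "0 < r" "r \<le> 1" "\<xi> \<in> B" by blast
  moreover have "norm \<xi> = 1" using x assms by auto
  ultimately show "x \<in> unit_cone B 1" by (auto simp: unit_cone_def)
qed

lemma unit_cone_measurable [measurable]:
  assumes [measurable]: "B \<in> sets borel"
  shows "unit_cone B R \<in> sets borel"
  unfolding unit_cone_def by measurable

lemma emeasure_unit_cone_1:
  fixes B :: "(real ^ 'd::finite) set"
  assumes "B \<in> sets borel" "B \<subseteq> sphere 0 1"
  shows "emeasure sphere_measure B = of_nat CARD('d) * emeasure lborel (unit_cone B 1)"
  by (simp add: unit_cone_1 assms emeasure_sphere_measure)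

lemma emeasure_unit_cone_finite:
  fixes B :: "(real ^ 'd::finite) set"
  shows "emeasure lborel (unit_cone B R) < \<infinity>"
proof -
  have "emeasure lborel (unit_cone B R) \<le> emeasure lborel (cball 0 R :: (real ^ 'd) set)"
    by (rule emeasure_mono) (auto simp: unit_cone_def)
  also have "\<dots> < \<infinity>"
    by (rule emeasure_lborel_cball_finite)
  finally show ?thesis .
qed

lemma emeasure_unit_cone:
  fixes B :: "(real ^ 'd::finite) set"
  assumes B: "B \<in> sets borel" and R: "0 < R"
  shows "emeasure lborel (unit_cone B R) = ennreal (R ^ CARD('d)) * emeasure lborel (unit_cone B 1)"
proof -
  \<comment> \<open>Dilation by \<open>R\<close> carries the cone of radius 1 onto that of radius
    \<open>R\<close>; the \<open>+ 0\<close> matches the affine form of the scaling rule for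
    Lebesgue measure.\<close>
  have "(\<lambda>x. R *\<^sub>R x + 0) ` unit_cone B 1 = unit_cone B R"
  proof (intro subset_antisym subsetI)
    fix x assume x: "x \<in> unit_cone B R"
    then have "(1 / R) *\<^sub>R x \<in> unit_cone B 1"
      using R by (auto simp: unit_cone_def field_simps)
    moreover have "x = R *\<^sub>R ((1 / R) *\<^sub>R x) + 0" using R by simp
    ultimately show "x \<in> (\<lambda>x. R *\<^sub>R x + 0) ` unit_cone B 1" by blast
  next
    fix x assume "x \<in> (\<lambda>x. R *\<^sub>R x + 0) ` unit_cone B 1"
    then show "x \<in> unit_cone B R"
      using R by (auto simp: unit_cone_def field_simps)
  qed
  then have "emeasure lebesgue (unit_cone B R) = ennreal (\<bar>R\<bar> ^ CARD('d)) * emeasure lebesgue (unit_cone B 1)"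
    using emeasure_lebesgue_affine[of R 0 "unit_cone B 1"] by simp
  then show ?thesis
    using B R by simp
qed

lemma finite_measure_sphere_measure: "finite_measure (sphere_measure :: (real ^ 'd::finite) measure)"
proof
  have "emeasure sphere_measure (sphere 0 1 :: (real ^ 'd) set) < \<infinity>"
    by (subst emeasure_unit_cone_1)
       (auto simp: ennreal_mult_less_top emeasure_unit_cone_finite[unfolded infinity_ennreal_def]
         ennreal_of_nat_eq_real_of_nat)
  then show "emeasure sphere_measure (space sphere_measure :: (real ^ 'd) set) \<noteq> \<infinity>"
    by (simp add: space_sphere_measure)
qed

definition radial_measure :: "nat \<Rightarrow> real measure" where
  "radial_measure d = density lborel (\<lambda>r. ennreal (indicator {0<..} r * r ^ (d - 1)))"

lemma sets_radial_measure [measurable_cong, simp]: "sets (radial_measure d) = sets borel"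
  by (simp add: radial_measure_def)

lemma sigma_finite_radial_measure: "sigma_finite_measure (radial_measure d)"
  unfolding radial_measure_def
  by (subst sigma_finite_measure.sigma_finite_iff_density_finite[OF sigma_finite_lborel]) auto

lemma emeasure_radial_measure_atMost:
  assumes "d > 0"
  shows "emeasure (radial_measure d) {..R} = ennreal (if R > 0 then R ^ d / real d else 0)"
proof (cases "R > 0")
  case True
  have "emeasure (radial_measure d) {..R} =
      (\<integral>\<^sup>+r. ennreal (indicator {0<..} r * r ^ (d - 1)) * indicator {..R} r \<partial>lborel)"
    unfolding radial_measure_def by (subst emeasure_density) auto
  also have "\<dots> = (\<integral>\<^sup>+r. ennreal (r ^ (d - 1)) * indicator {0..R} r \<partial>lborel)"
    by (rule nn_integral_cong_AE, rule eventually_mono[OF AE_lborel_singleton[of 0]])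
       (auto simp: indicator_def)
  also have "\<dots> = ennreal (R ^ d / real d - 0 ^ d / real d)"
    using True assms by (intro nn_integral_FTC_Icc) (auto intro!: derivative_eq_intros)
  finally show ?thesis using True assms by (simp add: zero_power)
next
  case False
  have "emeasure (radial_measure d) {..R} =
      (\<integral>\<^sup>+r. ennreal (indicator {0<..} r * r ^ (d - 1)) * indicator {..R} r \<partial>lborel)"
    unfolding radial_measure_def by (subst emeasure_density) auto
  also have "\<dots> = (\<integral>\<^sup>+(r::real). 0 \<partial>lborel)"
    using False by (intro nn_integral_cong) (auto simp: indicator_def)
  finally show ?thesis using False by simp
qed

text \<open>The half-lines \<open>{..R}\<close> form an intersection-stable generator of the Borel
  sets, so it suffices to compare cone volumes. These grow like R^d by dilation, and the factor d in
  \<open>sphere_measure\<close> cancels the 1/d from integrating r^(d-1).\<close>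

lemma polar_measure_slice:
  fixes B :: "(real ^ 'd::finite) set"
  assumes B: "B \<in> sets borel" "B \<subseteq> sphere 0 1"
  shows "distr (restrict_space lborel {x. x \<noteq> 0 \<and> x /\<^sub>R norm x \<in> B}) borel norm =
    scale_measure (emeasure sphere_measure B) (radial_measure CARD('d))" (is "?M = ?N")
proof (rule measure_eqI_generator_eq)
  let ?C = "{x. x \<noteq> 0 \<and> x /\<^sub>R norm x \<in> B}"
  have C: "?C \<in> sets borel" using B(1) by measurable
  have nm: "norm \<in> measurable (restrict_space lborel ?C) borel"
    by (rule measurable_restrict_space1) simp
  have M: "emeasure ?M {..R} = emeasure lborel (unit_cone B R)" for R
  proof -
    have "emeasure ?M {..R} = emeasure (restrict_space lborel ?C) (norm -` {..R} \<inter> ?C)"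
      using emeasure_distr[OF nm, of "{..R}"] by (simp add: space_restrict_space)
    also have "norm -` {..R} \<inter> ?C = unit_cone B R"
      by (auto simp: unit_cone_def)
    also have "emeasure (restrict_space lborel ?C) (unit_cone B R) = emeasure lborel (unit_cone B R)"
      by (rule emeasure_restrict_space) (use C in \<open>auto simp: unit_cone_def\<close>)
    finally show ?thesis .
  qed
  have eq: "emeasure ?M {..R} = emeasure ?N {..R}" for R
  proof (cases "R > 0")
    case True
    have "ennreal (R ^ CARD('d)) = of_nat CARD('d) * ennreal (R ^ CARD('d) / real CARD('d))"
      using True by (simp add: ennreal_of_nat_eq_real_of_nat ennreal_mult'[symmetric])
    then show ?thesis
      using True unfolding M emeasure_unit_cone[OF B(1) True]
      by (simp add: emeasure_unit_cone_1[OF B] emeasure_radial_measure_atMost mult_ac)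
  next
    case False
    then have "unit_cone B R = {}"
      by (auto simp: unit_cone_def dest: order_trans[of _ "norm _"])
         (metis norm_le_zero_iff order_trans not_less)
    then show ?thesis
      using False by (simp add: M emeasure_radial_measure_atMost)
  qed
  let ?E = "range (\<lambda>a::real. {..a})"
  show "Int_stable ?E"
    by (auto simp: Int_stable_def)
  show "?E \<subseteq> Pow UNIV" by simp
  show "emeasure ?M X = emeasure ?N X" if "X \<in> ?E" for X
    using that eq by auto
  have "sets (borel :: real measure) = sigma_sets UNIV ?E"
    by (subst borel_eq_atMost) simp
  then show "sets ?M = sigma_sets UNIV ?E" "sets ?N = sigma_sets UNIV ?E"
    by simp_all
  show "range (\<lambda>n::nat. {..real n}) \<subseteq> ?E" by auto
  show "(\<Union>n::nat. {..real n}) = UNIV"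
    using real_arch_simple by auto
  show "emeasure ?M {..real n} \<noteq> \<infinity>" for n
    using emeasure_unit_cone_finite[of B "real n"] by (auto simp: M)
qed

lemma measurable_polar [measurable]:
  "(\<lambda>x::real ^ 'd::finite. (norm x, x /\<^sub>R norm x)) \<in> measurable (restrict_space lborel (- {0}))
     (borel \<Otimes>\<^sub>M restrict_space borel (sphere 0 1))"
proof (rule measurable_Pair)
  show "norm \<in> measurable (restrict_space lborel (- {0::real ^ 'd})) borel"
    by (rule measurable_restrict_space1) simp
  show "(\<lambda>x. x /\<^sub>R norm x) \<in> measurable (restrict_space lborel (- {0::real ^ 'd})) (restrict_space borel (sphere 0 1))"
    by (intro measurable_restrict_space2 measurable_restrict_space1) (auto simp: space_restrict_space)
qed

text \<open>A sigma-finite product measure is determined by its values on rectangles A x B, and for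
  fixed B these are given by the slice lemma.\<close>

lemma polar_measure:
  "radial_measure CARD('d) \<Otimes>\<^sub>M (sphere_measure :: (real ^ 'd::finite) measure) =
     distr (restrict_space lborel (- {0})) (borel \<Otimes>\<^sub>M restrict_space borel (sphere 0 1))
       (\<lambda>x. (norm x, x /\<^sub>R norm x))"
proof (rule pair_measure_eqI)
  show "sigma_finite_measure (radial_measure CARD('d))"
    by (rule sigma_finite_radial_measure)
  show "sigma_finite_measure (sphere_measure :: (real ^ 'd) measure)"
    by (rule finite_measure.axioms(1)[OF finite_measure_sphere_measure])
  show "sets (radial_measure CARD('d) \<Otimes>\<^sub>M (sphere_measure :: (real ^ 'd) measure)) =
     sets (distr (restrict_space lborel (- {0})) (borel \<Otimes>\<^sub>M restrict_space borel (sphere 0 1))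
       (\<lambda>x. (norm x, x /\<^sub>R norm x)))"
    by (simp add: sets_sphere_measure cong: sets_pair_measure_cong)
  fix A :: "real set" and B :: "(real ^ 'd) set"
  assume A: "A \<in> sets (radial_measure CARD('d))" and "B \<in> sets sphere_measure"
  then have B: "B \<in> sets borel" "B \<subseteq> sphere 0 1" "B \<in> sets (restrict_space borel (sphere 0 1))"
    by (auto simp: sets_sphere_measure sets_restrict_space)
  let ?C = "{x. x \<noteq> 0 \<and> x /\<^sub>R norm x \<in> B}"
  have C: "?C \<in> sets borel" using B(1) by measurable
  have nm: "norm \<in> measurable (restrict_space lborel ?C) borel"
    by (rule measurable_restrict_space1) simp
  have A': "A \<in> sets borel" using A by simp
  have "emeasure (radial_measure CARD('d)) A * emeasure sphere_measure B =
      emeasure (distr (restrict_space lborel ?C) borel norm) A"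
    by (simp add: polar_measure_slice[OF B(1,2)] mult.commute)
  also have "\<dots> = emeasure (restrict_space lborel ?C) (norm -` A \<inter> ?C)"
    using emeasure_distr[OF nm A'] by (simp add: space_restrict_space)
  also have "\<dots> = emeasure lborel (norm -` A \<inter> ?C)"
    by (rule emeasure_restrict_space) (use C in auto)
  also have "\<dots> = emeasure (restrict_space lborel (- {0})) (norm -` A \<inter> ?C)"
    by (rule emeasure_restrict_space[symmetric]) auto
  also have "norm -` A \<inter> ?C = (\<lambda>x. (norm x, x /\<^sub>R norm x)) -` (A \<times> B) \<inter> space (restrict_space lborel (- {0}))"
    by (auto simp: space_restrict_space)
  also have "emeasure (restrict_space lborel (- {0})) \<dots> =
    emeasure (distr (restrict_space lborel (- {0})) (borel \<Otimes>\<^sub>M restrict_space borel (sphere 0 1))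
       (\<lambda>x. (norm x, x /\<^sub>R norm x))) (A \<times> B)"
    by (rule emeasure_distr[symmetric]) (use A' B(3) in auto)
  finally show "emeasure (radial_measure CARD('d)) A * emeasure sphere_measure B = \<dots>" .
qed

lemma sphere_measure_integral_measurable:
  fixes F :: "real ^ 'd::finite \<Rightarrow> real"
  assumes [measurable]: "F \<in> borel_measurable borel"
  shows "(\<lambda>r. LINT \<xi>|sphere_measure. F (r *\<^sub>R \<xi>)) \<in> borel_measurable borel"
proof -
  interpret S: finite_measure "sphere_measure :: (real ^ 'd) measure"
    by (rule finite_measure_sphere_measure)
  have [measurable]: "(\<lambda>x. x) \<in> measurable (sphere_measure :: (real ^ 'd) measure) borel"
    by (subst measurable_cong_sets[OF sets_sphere_measure refl]) (rule measurable_restrict_space1, simp)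
  show ?thesis
    by (intro S.borel_measurable_lebesgue_integral) measurable
qed

text \<open>Fubini on the product representation of Lebesgue measure; deleting the origin, where the
  direction is meaningless, changes nothing because it is a null set.\<close>

lemma polar_coordinates:
  fixes F :: "real ^ 'd::finite \<Rightarrow> real"
  assumes F: "integrable lborel F"
  shows "set_integrable lborel {0<..} (\<lambda>r. r ^ (CARD('d) - 1) * (LINT \<xi>|sphere_measure. F (r *\<^sub>R \<xi>)))"
    and "(LINT r:{0<..}|lborel. r ^ (CARD('d) - 1) * (LINT \<xi>|sphere_measure. F (r *\<^sub>R \<xi>))) = (LINT x|lborel. F x)"
proof -
  let ?S = "sphere_measure :: (real ^ 'd) measure" and ?R = "radial_measure CARD('d)"
  let ?L = "restrict_space lborel (- {0}) :: (real ^ 'd) measure"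
  let ?G = "\<lambda>r. LINT \<xi>|?S. F (r *\<^sub>R \<xi>)"
  let ?p = "\<lambda>x::real ^ 'd. (norm x, x /\<^sub>R norm x)"
  let ?H = "\<lambda>(r, \<xi>). F (r *\<^sub>R \<xi>)"
  have [measurable]: "F \<in> borel_measurable borel" using F by auto
  note sphere_measure_integral_measurable[OF this, measurable]
  interpret S: finite_measure ?S by (rule finite_measure_sphere_measure)
  interpret R: sigma_finite_measure ?R by (rule sigma_finite_radial_measure)
  interpret pair_sigma_finite ?R ?S ..
  have [measurable]: "(\<lambda>x. x) \<in> measurable (restrict_space borel (sphere 0 1) :: (real ^ 'd) measure) borel"
    by (rule measurable_restrict_space1) simp
  have H: "?H \<in> borel_measurable (borel \<Otimes>\<^sub>M restrict_space borel (sphere 0 1))"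
    by measurable
  have Hp: "?H (?p x) = F x" if "x \<in> space ?L" for x
    using that by (simp add: space_restrict_space)
  have AE: "AE x in lborel. indicator (- {0}) x *\<^sub>R F x = F x"
    by (rule eventually_mono[OF AE_lborel_singleton[of 0]]) auto
  have FL: "integrable ?L F" and FLi: "integral\<^sup>L ?L F = integral\<^sup>L lborel F"
  proof -
    show "integrable ?L F"
      unfolding integrable_restrict_space[of "- {0}" lborel, simplified]
      using F by (intro integrable_cong_AE[OF _ _ AE, THEN iffD2]) simp_all
    show "integral\<^sup>L ?L F = integral\<^sup>L lborel F"
      by (subst integral_restrict_space, simp, rule integral_cong_AE[OF _ _ AE]) simp_all
  qed
  have int: "integrable (?R \<Otimes>\<^sub>M ?S) ?H"
    unfolding polar_measure integrable_distr_eq[OF measurable_polar H]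
  proof -
    have "integrable ?L (\<lambda>x. ?H (?p x)) \<longleftrightarrow> integrable ?L F"
      by (rule Bochner_Integration.integrable_cong[OF refl]) (rule Hp)
    then show "integrable ?L (\<lambda>x. ?H (?p x))" using FL by blast
  qed
  have eq: "integral\<^sup>L (?R \<Otimes>\<^sub>M ?S) ?H = integral\<^sup>L lborel F"
    unfolding polar_measure FLi[symmetric]
    by (subst integral_distr[OF measurable_polar H]) (rule Bochner_Integration.integral_cong[OF refl Hp])
  have w: "AE r in lborel. 0 \<le> indicator {0<..} r * (r::real) ^ (CARD('d) - 1)"
    by (rule AE_I2) (simp add: indicator_def)
  have iR: "integrable ?R ?G"
    using integrable_fst'[OF int] by simp
  then show "set_integrable lborel {0<..} (\<lambda>r. r ^ (CARD('d) - 1) * ?G r)"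
    unfolding radial_measure_def set_integrable_def
    by (subst (asm) integrable_density[OF _ _ w]) (auto simp: mult_ac)
  have "integral\<^sup>L ?R ?G = integral\<^sup>L lborel F"
    using integral_fst'[OF int] eq by simp
  then show "(LINT r:{0<..}|lborel. r ^ (CARD('d) - 1) * ?G r) = integral\<^sup>L lborel F"
    unfolding radial_measure_def set_lebesgue_integral_def
    by (subst (asm) integral_density[OF _ _ w]) (auto simp: mult_ac)
qed


section \<open>Polynomials and the Gaussian weight\<close>

definition vmon :: "('d::finite \<Rightarrow> nat) \<Rightarrow> real ^ 'd \<Rightarrow> real" where
  "vmon \<alpha> x = (\<Prod>i\<in>UNIV. x $ i ^ \<alpha> i)"

definition polyd :: "nat \<Rightarrow> (real ^ 'd::finite \<Rightarrow> real) set" where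
  "polyd n = {f. \<exists>c. f = (\<lambda>x. \<Sum>\<alpha> | sum \<alpha> UNIV \<le> n. c \<alpha> * vmon \<alpha> x)}"

lemma finite_exponents_le: "finite {\<alpha> :: 'd::finite \<Rightarrow> nat. sum \<alpha> UNIV \<le> n}"
proof -
  have "{\<alpha> :: 'd \<Rightarrow> nat. sum \<alpha> UNIV \<le> n} \<subseteq> fst ` {(\<alpha>, k). sum \<alpha> UNIV + k \<le> n}"
    by (auto intro!: image_eqI[where x = "(_, 0)"])
  then show ?thesis
    by (rule finite_subset) (intro finite_imageI finite_exponents)
qed

lemma vmon_mult: "vmon \<alpha> x * vmon \<beta> x = vmon (\<lambda>i. \<alpha> i + \<beta> i) x"
  by (simp add: vmon_def power_add prod.distrib)

lemma vmon_scaleR: "vmon \<alpha> (r *\<^sub>R x) = r ^ sum \<alpha> UNIV * vmon \<alpha> x"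
  by (simp add: vmon_def power_mult_distrib prod.distrib power_sum)

lemma vmon_split: "vmon \<alpha> x = x $ i ^ \<alpha> i * (\<Prod>j\<in>UNIV - {i}. x $ j ^ \<alpha> j)"
  unfolding vmon_def by (rule prod.remove) auto

lemma continuous_on_vmon: "continuous_on S (vmon \<alpha>)"
  unfolding vmon_def by (intro continuous_intros)

lemma vmon_in_polyd:
  fixes \<alpha> :: "'d::finite \<Rightarrow> nat"
  assumes "sum \<alpha> UNIV \<le> n"
  shows "vmon \<alpha> \<in> polyd n"
proof -
  have "(\<Sum>\<beta> | sum \<beta> UNIV \<le> n. of_bool (\<beta> = \<alpha>) * vmon \<beta> x)
      = (\<Sum>\<beta> | sum \<beta> UNIV \<le> n. if \<beta> = \<alpha> then vmon \<beta> x else 0)" for x :: "real ^ 'd"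
    by (intro sum.cong) auto
  also have "\<dots> x = vmon \<alpha> x" for x :: "real ^ 'd"
    using assms by (subst sum.delta) (auto simp: finite_exponents_le)
  finally show ?thesis
    unfolding polyd_def by (intro CollectI exI[of _ "\<lambda>\<beta>. of_bool (\<beta> = \<alpha>)"]) auto
qed

lemma polyd_zero: "(\<lambda>x. 0) \<in> polyd n"
  unfolding polyd_def by (intro CollectI exI[of _ "\<lambda>_. 0"]) auto

lemma polyd_add: "f \<in> polyd n \<Longrightarrow> g \<in> polyd n \<Longrightarrow> (\<lambda>x. f x + g x) \<in> polyd n"
proof -
  assume "f \<in> polyd n" "g \<in> polyd n"
  then obtain c d where "f = (\<lambda>x. \<Sum>\<alpha> | sum \<alpha> UNIV \<le> n. c \<alpha> * vmon \<alpha> x)"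
    "g = (\<lambda>x. \<Sum>\<alpha> | sum \<alpha> UNIV \<le> n. d \<alpha> * vmon \<alpha> x)"
    unfolding polyd_def by blast
  then have "(\<lambda>x. f x + g x) = (\<lambda>x. \<Sum>\<alpha> | sum \<alpha> UNIV \<le> n. (c \<alpha> + d \<alpha>) * vmon \<alpha> x)"
    by (simp add: distrib_right sum.distrib)
  then show ?thesis unfolding polyd_def by (intro CollectI exI)
qed

lemma polyd_cmult: "f \<in> polyd n \<Longrightarrow> (\<lambda>x. a * f x) \<in> polyd n"
proof -
  assume "f \<in> polyd n"
  then obtain c where "f = (\<lambda>x. \<Sum>\<alpha> | sum \<alpha> UNIV \<le> n. c \<alpha> * vmon \<alpha> x)"
    unfolding polyd_def by blast
  then have "(\<lambda>x. a * f x) = (\<lambda>x. \<Sum>\<alpha> | sum \<alpha> UNIV \<le> n. (a * c \<alpha>) * vmon \<alpha> x)"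
    by (simp add: sum_distrib_left mult.assoc)
  then show ?thesis unfolding polyd_def by (intro CollectI exI)
qed

lemma polyd_sum: "(\<And>i. i \<in> I \<Longrightarrow> f i \<in> polyd n) \<Longrightarrow> (\<lambda>x. \<Sum>i\<in>I. f i x) \<in> polyd n"
  by (induction I rule: infinite_finite_induct) (auto intro: polyd_zero polyd_add)

lemma polydE:
  assumes "f \<in> polyd n"
  obtains c where "f = (\<lambda>x. \<Sum>\<alpha> | sum \<alpha> UNIV \<le> n. c \<alpha> * vmon \<alpha> x)"
  using assms unfolding polyd_def by blast

lemma polyd_mono: "f \<in> polyd m \<Longrightarrow> m \<le> n \<Longrightarrow> f \<in> polyd n"
  by (erule polydE) (auto intro!: polyd_sum polyd_cmult vmon_in_polyd)

lemma polyd_mult: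
  assumes "f \<in> polyd m" "g \<in> polyd n"
  shows "(\<lambda>x. f x * g x) \<in> polyd (m + n)"
proof -
  obtain c where f: "f = (\<lambda>x. \<Sum>\<alpha> | sum \<alpha> UNIV \<le> m. c \<alpha> * vmon \<alpha> x)"
    using assms(1) by (rule polydE)
  obtain d where g: "g = (\<lambda>x. \<Sum>\<alpha> | sum \<alpha> UNIV \<le> n. d \<alpha> * vmon \<alpha> x)"
    using assms(2) by (rule polydE)
  have "(\<lambda>x. f x * g x) = (\<lambda>x. \<Sum>\<alpha> | sum \<alpha> UNIV \<le> m. \<Sum>\<beta> | sum \<beta> UNIV \<le> n.
      (c \<alpha> * d \<beta>) * vmon (\<lambda>i. \<alpha> i + \<beta> i) x)"
    unfolding f g by (simp add: sum_product vmon_mult[symmetric] mult_ac)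
  also have "\<dots> \<in> polyd (m + n)"
    by (intro polyd_sum polyd_cmult vmon_in_polyd) (auto simp: sum.distrib intro: add_mono)
  finally show ?thesis .
qed

lemma polyd_const: "(\<lambda>x. a) \<in> polyd n"
  using polyd_cmult[OF vmon_in_polyd[of "\<lambda>_. 0" n], of a] by (simp add: vmon_def)

lemma polyd_power: "f \<in> polyd m \<Longrightarrow> (\<lambda>x. f x ^ k) \<in> polyd (k * m)"
  by (induction k) (auto intro: polyd_const polyd_mult)

lemma polyd_norm_square: "(\<lambda>x::real ^ 'd::finite. (norm x)\<^sup>2) \<in> polyd 2"
proof -
  have "vmon (\<lambda>j. if j = i then 2 else 0) x = (x $ i)\<^sup>2" for i and x :: "real ^ 'd"
    by (subst vmon_split[of _ _ i]) auto
  then have "(\<lambda>x::real ^ 'd. (norm x)\<^sup>2) = (\<lambda>x. \<Sum>i\<in>UNIV. vmon (\<lambda>j. if j = i then 2 else 0) x)"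
    by (auto simp: norm_vec_def L2_set_def sum_nonneg)
  also have "\<dots> \<in> polyd 2"
    by (intro polyd_sum vmon_in_polyd) auto
  finally show ?thesis .
qed

lemma continuous_on_polyd: "f \<in> polyd n \<Longrightarrow> continuous_on S f"
  by (erule polydE) (auto intro!: continuous_intros continuous_on_vmon)

text \<open>\<open>\<Delta> - 2 x \<cdot> \<nabla>\<close> applied to a monomial; when \<open>\<alpha> i < 2\<close> the coefficient vanishes and
  the truncated exponent \<open>\<alpha> i - 2\<close> is irrelevant.\<close>

definition hermite_op :: "('d::finite \<Rightarrow> nat) \<Rightarrow> real ^ 'd \<Rightarrow> real" where
  "hermite_op \<alpha> x = (\<Sum>i\<in>UNIV. real (\<alpha> i) * (real (\<alpha> i) - 1) * vmon (\<alpha>(i := \<alpha> i - 2)) x)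
     - 2 * real (sum \<alpha> UNIV) * vmon \<alpha> x"

text \<open>Stated with additions on both sides, so that lowering an exponent never involves a
  truncated subtraction of degrees.\<close>

lemma sum_fun_upd_UNIV:
  fixes \<alpha> :: "'d::finite \<Rightarrow> nat"
  shows "sum (\<alpha>(i := k)) UNIV + \<alpha> i = sum \<alpha> UNIV + k"
proof -
  have "sum (\<alpha>(i := k)) UNIV = k + sum \<alpha> (UNIV - {i})"
    by (subst sum.remove[of _ i]) (auto intro!: sum.cong)
  moreover have "sum \<alpha> UNIV = \<alpha> i + sum \<alpha> (UNIV - {i})"
    by (rule sum.remove) auto
  ultimately show ?thesis by simp
qed

lemma laplacian_part_in_polyd:
  fixes \<alpha> :: "'d::finite \<Rightarrow> nat"
  assumes "sum \<alpha> UNIV \<le> m + 2"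
  shows "(\<lambda>x. \<Sum>i\<in>UNIV. real (\<alpha> i) * (real (\<alpha> i) - 1) * vmon (\<alpha>(i := \<alpha> i - 2)) x) \<in> polyd m"
proof (rule polyd_sum)
  fix i
  show "(\<lambda>x. real (\<alpha> i) * (real (\<alpha> i) - 1) * vmon (\<alpha>(i := \<alpha> i - 2)) x) \<in> polyd m"
  proof (cases "\<alpha> i \<ge> 2")
    case True
    then have "sum (\<alpha>(i := \<alpha> i - 2)) UNIV \<le> m"
      using sum_fun_upd_UNIV[of \<alpha> i "\<alpha> i - 2"] assms by linarith
    then show ?thesis by (intro polyd_cmult vmon_in_polyd)
  next
    case False
    then have "\<alpha> i = 0 \<or> \<alpha> i = 1" by linarith
    then show ?thesis by (auto simp: polyd_zero)
  qed
qed

lemma hermite_op_in_polyd: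
  assumes "sum \<alpha> UNIV \<le> m"
  shows "hermite_op \<alpha> \<in> polyd m"
proof -
  have "(\<lambda>x. (\<Sum>i\<in>UNIV. real (\<alpha> i) * (real (\<alpha> i) - 1) * vmon (\<alpha>(i := \<alpha> i - 2)) x)
     + (- 2 * real (sum \<alpha> UNIV)) * vmon \<alpha> x) \<in> polyd m"
    using assms by (intro polyd_add polyd_cmult laplacian_part_in_polyd vmon_in_polyd) auto
  then show ?thesis by (simp add: hermite_op_def[abs_def])
qed

text \<open>The terms of top degree cancel.\<close>

lemma hermite_op_add_in_polyd:
  assumes "sum \<alpha> UNIV \<le> Suc m"
  shows "(\<lambda>x. hermite_op \<alpha> x + 2 * real (Suc m) * vmon \<alpha> x) \<in> polyd m"
proof (cases "sum \<alpha> UNIV = Suc m")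
  case True
  then show ?thesis
    using laplacian_part_in_polyd[of \<alpha> m]
    by (simp add: hermite_op_def[abs_def] del: of_nat_sum of_nat_Suc)
next
  case False
  with assms show ?thesis
    by (intro polyd_add polyd_cmult hermite_op_in_polyd vmon_in_polyd) auto
qed

section \<open>One-dimensional Gaussian moments\<close>

definition gauss_moment :: "nat \<Rightarrow> real" where
  "gauss_moment k = (LBINT x. x ^ k * exp (- x\<^sup>2))"

lemma has_bochner_integral_gauss_even: "has_bochner_integral lborel (\<lambda>x::real. x ^ (2 * k) * exp (- x\<^sup>2))
   (sqrt pi * (fact (2 * k) / (2 ^ (2 * k) * fact k)))"
  using has_bochner_integral_even_function[OF gaussian_moment_even_pos[where k=k]]
  by (simp add: mult_ac)

lemma has_bochner_integral_gauss_odd: "has_bochner_integral lborel (\<lambda>x::real. x ^ (2 * k + 1) * exp (- x\<^sup>2)) 0"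
  using has_bochner_integral_odd_function[OF gaussian_moment_odd_pos[where k=k]]
  by (simp add: mult_ac)

lemma integrable_gauss_moment: "integrable lborel (\<lambda>x::real. x ^ k * exp (- x\<^sup>2))"
  using has_bochner_integral_gauss_even[of "k div 2"] has_bochner_integral_gauss_odd[of "k div 2"]
  by (cases "even k") (auto simp: has_bochner_integral_iff)

lemma gauss_moment_one: "gauss_moment 1 = 0"
  using has_bochner_integral_gauss_odd[of 0] by (simp add: gauss_moment_def has_bochner_integral_iff)

text \<open>Integration by parts in disguise, read off from the closed form sqrt pi (2j)! / (4^j j!)
  of the even moments; for odd k both moments vanish.\<close>

lemma gauss_moment_rec: "2 * gauss_moment (k + 2) = (real k + 1) * gauss_moment k"
proof (cases "even k")
  case True
  then obtain j where j: "k = 2 * j" by blast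
  have "gauss_moment (2 * i) = sqrt pi * (fact (2 * i) / (2 ^ (2 * i) * fact i))" for i
    using has_bochner_integral_gauss_even[of i] by (simp add: gauss_moment_def has_bochner_integral_iff)
  moreover have "fact (2 * Suc j) = 2 * (real j + 1) * (2 * real j + 1) * fact (2 * j)"
    by (simp add: algebra_simps)
  moreover have "(2::real) ^ (2 * Suc j) = 4 * 2 ^ (2 * j)" "fact (Suc j) = (real j + 1) * fact j"
    by simp_all
  ultimately have "2 * gauss_moment (2 * Suc j) = (2 * real j + 1) * gauss_moment (2 * j)"
    by (simp only:) (simp add: divide_simps)
  then show ?thesis by (simp add: j)
next
  case False
  then obtain j where j: "k = 2 * j + 1" by (elim oddE) 
  have "gauss_moment (2 * i + 1) = 0" for i
    using has_bochner_integral_gauss_odd[of i] by (simp add: gauss_moment_def has_bochner_integral_iff)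
  from this[of j] this[of "Suc j"] show ?thesis
    by (simp add: j)
qed

text \<open>This is symmetry of f'' - 2 x f' on the monomials x^a and x^b. With k = a + b - 2 the
  recurrence turns both sides into - a b \<open>gauss_moment k\<close>. If a + b < 2 there is no
  such k, and only the vanishing of the first moment is at stake.\<close>

lemma gauss_moment_sym:
  "real a * (real a - 1) * gauss_moment (a - 2 + b) - 2 * real a * gauss_moment (a + b)
     = real b * (real b - 1) * gauss_moment (a + (b - 2)) - 2 * real b * gauss_moment (a + b)"
proof (cases "a + b < 2")
  case True
  then have "(a = 0 \<and> b = 0) \<or> (a = 1 \<and> b = 0) \<or> (a = 0 \<and> b = 1)" by linarith
  then show ?thesis using gauss_moment_one by auto
next
  case False
  define k where "k = a + b - 2"
  have ab: "a + b = k + 2" using False by (simp add: k_def)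
  \<comment> \<open>The truncated exponent x - 2 is wrong only for x < 2, where the coefficient x (x
    - 1) is zero.\<close>
  have 1: "real x * (real x - 1) * gauss_moment (x - 2 + y) = real x * (real x - 1) * gauss_moment k"
    if "x + y = k + 2" for x y
  proof (cases "x \<ge> 2")
    case True
    then have "x - 2 + y = k" using that by linarith
    then show ?thesis by simp
  next
    case False
    then have "x = 0 \<or> x = 1" by linarith
    then show ?thesis by auto
  qed
  have r: "real b = real k + 2 - real a" using ab by linarith
  have "real a * (real a - 1) * gauss_moment (a - 2 + b) - 2 * real a * gauss_moment (a + b)
     = real a * (real a - 1) * gauss_moment k - real a * (2 * gauss_moment (k + 2))"
    using 1[of a b] ab by simp
  also have "\<dots> = real b * (real b - 1) * gauss_moment k - real b * (2 * gauss_moment (k + 2))"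
    unfolding gauss_moment_rec r by algebra
  also have "\<dots> = real b * (real b - 1) * gauss_moment (a + (b - 2)) - 2 * real b * gauss_moment (a + b)"
    using 1[of b a] ab by (auto simp: add.commute)
  finally show ?thesis .
qed

section \<open>Gaussian integrals of polynomials in several variables\<close>

lemma lborel_prod_has_bochner_integral:
  fixes f :: "'a::euclidean_space \<Rightarrow> real \<Rightarrow> real"
  assumes int: "\<And>b. b \<in> Basis \<Longrightarrow> integrable lborel (f b)"
  shows "has_bochner_integral lborel (\<lambda>x. \<Prod>b\<in>Basis. f b (x \<bullet> b)) (\<Prod>b\<in>Basis. LBINT t. f b t)"
proof -
  interpret product_sigma_finite "\<lambda>_::'a. lborel :: real measure" ..
  have [measurable]: "b \<in> Basis \<Longrightarrow> f b \<in> borel_measurable borel" for b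
    using int[of b] by auto
  have eq: "(\<Prod>b\<in>Basis. f b ((\<Sum>c\<in>Basis. y c *\<^sub>R c) \<bullet> b)) = (\<Prod>b\<in>Basis. f b (y b))" for y
    by (intro prod.cong) auto
  show ?thesis
    unfolding has_bochner_integral_iff
  proof
    show "integrable lborel (\<lambda>x. \<Prod>b\<in>Basis. f b (x \<bullet> b))"
      unfolding lborel_eq[where 'a='a]
      by (subst integrable_distr_eq) (auto simp: eq intro!: product_integrable_prod int)
    show "(LBINT x. \<Prod>b\<in>Basis. f b (x \<bullet> b)) = (\<Prod>b\<in>Basis. LBINT t. f b t)"
      unfolding lborel_eq[where 'a='a]
      by (subst integral_distr) (auto simp: eq intro!: product_integral_prod int)
  qed
qed

lemma lborel_vec_prod_has_bochner_integral:
  fixes f :: "'d::finite \<Rightarrow> real \<Rightarrow> real"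
  assumes int: "\<And>i. integrable lborel (f i)"
  shows "has_bochner_integral lborel (\<lambda>x::real ^ 'd. \<Prod>i\<in>UNIV. f i (x $ i)) (\<Prod>i\<in>UNIV. LBINT t. f i t)"
proof -
  have B: "(Basis :: (real ^ 'd) set) = range (\<lambda>i. axis i 1)"
    by (auto simp: Basis_vec_def)
  have inj: "inj (\<lambda>i::'d. axis i (1::real))"
    by (auto intro!: injI simp: axis_eq_axis)
  \<comment> \<open>The basis of \<open>real ^ 'd\<close> is a set of vectors, not indexed by
    \<open>'d\<close>; inverting \<open>axis\<close> recovers the coordinate from the basis
    vector.\<close>
  define g where "g b = f (inv (\<lambda>i. axis i (1::real)) b)" for b :: "real ^ 'd"
  have g: "g (axis i 1) = f i" for i
    by (simp add: g_def inv_f_f[OF inj])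
  have "has_bochner_integral lborel (\<lambda>x. \<Prod>b\<in>Basis. g b (x \<bullet> b)) (\<Prod>b\<in>Basis. LBINT t. g b t)"
    by (rule lborel_prod_has_bochner_integral) (auto simp: B g int)
  then show ?thesis
    by (simp add: B prod.reindex[OF inj] g inner_axis)
qed

definition gauss_integral :: "(real ^ 'd::finite \<Rightarrow> real) \<Rightarrow> real" where
  "gauss_integral f = (LBINT x. f x * exp (- (norm x)\<^sup>2))"

lemma has_bochner_integral_vmon:
  "has_bochner_integral lborel (\<lambda>x. vmon \<alpha> x * exp (- (norm x)\<^sup>2)) (\<Prod>i\<in>UNIV. gauss_moment (\<alpha> i))"
proof -
  have "exp (- (norm x)\<^sup>2) = (\<Prod>i\<in>UNIV. exp (- (x $ i)\<^sup>2))" for x :: "real ^ 'a"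
    by (simp add: norm_vec_def L2_set_def sum_nonneg exp_sum[symmetric] sum_negf)
  then have "(\<lambda>x. vmon \<alpha> x * exp (- (norm x)\<^sup>2)) = (\<lambda>x. \<Prod>i\<in>UNIV. x $ i ^ \<alpha> i * exp (- (x $ i)\<^sup>2))"
    by (simp add: vmon_def prod.distrib)
  then show ?thesis
    using lborel_vec_prod_has_bochner_integral[of "\<lambda>i t. t ^ \<alpha> i * exp (- t\<^sup>2)"] integrable_gauss_moment
    by (simp add: gauss_moment_def)
qed

lemma gauss_integral_vmon: "gauss_integral (vmon \<alpha>) = (\<Prod>i\<in>UNIV. gauss_moment (\<alpha> i))"
  using has_bochner_integral_vmon[of \<alpha>] by (simp add: gauss_integral_def has_bochner_integral_iff)

lemma gauss_integral_integrable:
  fixes f :: "real ^ 'd::finite \<Rightarrow> real"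
  assumes "f \<in> polyd n"
  shows "integrable lborel (\<lambda>x. f x * exp (- (norm x)\<^sup>2))"
proof -
  obtain c where "f = (\<lambda>x. \<Sum>\<alpha> | sum \<alpha> UNIV \<le> n. c \<alpha> * vmon \<alpha> x)"
    using assms by (rule polydE)
  then have "(\<lambda>x. f x * exp (- (norm x)\<^sup>2)) =
      (\<lambda>x. \<Sum>\<alpha> | sum \<alpha> UNIV \<le> n. c \<alpha> * (vmon \<alpha> x * exp (- (norm x)\<^sup>2)))"
    by (simp add: sum_distrib_right mult.assoc)
  moreover have "integrable lborel (\<lambda>x. vmon \<alpha> x * exp (- (norm x)\<^sup>2))" for \<alpha> :: "'d \<Rightarrow> nat"
    by (rule integrable.intros[OF has_bochner_integral_vmon])
  ultimately show ?thesis
    by (simp only:) (intro Bochner_Integration.integrable_sum integrable_mult_right)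
qed

lemma gauss_integral_add: "f \<in> polyd n \<Longrightarrow> g \<in> polyd m \<Longrightarrow> gauss_integral (\<lambda>x. f x + g x) = gauss_integral f + gauss_integral g"
  unfolding gauss_integral_def using gauss_integral_integrable[of f n] gauss_integral_integrable[of g m]
  by (simp add: distrib_right)

lemma gauss_integral_cmult: "gauss_integral (\<lambda>x. a * f x) = a * gauss_integral f"
  unfolding gauss_integral_def by (simp add: mult.assoc)

lemma gauss_integral_sum: "(\<And>i. i \<in> I \<Longrightarrow> f i \<in> polyd n) \<Longrightarrow> gauss_integral (\<lambda>x. \<Sum>i\<in>I. f i x) = (\<Sum>i\<in>I. gauss_integral (f i))"
  unfolding gauss_integral_def sum_distrib_right
  by (rule Bochner_Integration.integral_sum) (rule gauss_integral_integrable)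

text \<open>In the summand of coordinate i all other coordinates contribute plain moments, which
  isolates the one-dimensional operator that \<open>gauss_moment_sym\<close> treats.\<close>

lemma gauss_integral_hermite_op:
  "gauss_integral (\<lambda>x. hermite_op \<alpha> x * vmon \<beta> x) = (\<Sum>i\<in>UNIV.
     (real (\<alpha> i) * (real (\<alpha> i) - 1) * gauss_moment (\<alpha> i - 2 + \<beta> i) - 2 * real (\<alpha> i) * gauss_moment (\<alpha> i + \<beta> i))
       * (\<Prod>j\<in>UNIV - {i}. gauss_moment (\<alpha> j + \<beta> j)))"
proof -
  let ?c = "\<lambda>i. real (\<alpha> i) * (real (\<alpha> i) - 1)"
  let ?u = "\<lambda>i j. (\<alpha>(i := \<alpha> i - 2)) j + \<beta> j"
  let ?v = "\<lambda>j. \<alpha> j + \<beta> j"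
  let ?N = "sum ?v UNIV"
  have u: "vmon (?u i) \<in> polyd ?N" and v: "vmon ?v \<in> polyd ?N" for i
    by (auto intro!: vmon_in_polyd sum_mono)
  \<comment> \<open>The scalar - 2 |\<alpha>| is distributed over the coordinates as - 2 \<alpha> i,
    so that each summand pairs a second derivative with its own drift term.\<close>
  have "hermite_op \<alpha> x * vmon \<beta> x =
      (\<Sum>i\<in>UNIV. ?c i * vmon (?u i) x + (- 2 * real (\<alpha> i)) * vmon ?v x)" for x
    by (simp add: hermite_op_def left_diff_distrib sum_distrib_right sum.distrib vmon_mult mult.assoc
       sum_distrib_left sum_negf sum_subtractf)
  then have "gauss_integral (\<lambda>x. hermite_op \<alpha> x * vmon \<beta> x) =
      (\<Sum>i\<in>UNIV. gauss_integral (\<lambda>x. ?c i * vmon (?u i) x + (- 2 * real (\<alpha> i)) * vmon ?v x))"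
    by (simp only:) (rule gauss_integral_sum[where n = ?N], rule polyd_add[OF polyd_cmult[OF u] polyd_cmult[OF v]])
  also have "\<dots> = (\<Sum>i\<in>UNIV. ?c i * gauss_integral (vmon (?u i)) + (- 2 * real (\<alpha> i)) * gauss_integral (vmon ?v))"
    by (subst gauss_integral_add[OF polyd_cmult[OF u] polyd_cmult[OF v]]) (simp only: gauss_integral_cmult)
  also have "\<dots> = (\<Sum>i\<in>UNIV.
     (?c i * gauss_moment (\<alpha> i - 2 + \<beta> i) - 2 * real (\<alpha> i) * gauss_moment (\<alpha> i + \<beta> i))
       * (\<Prod>j\<in>UNIV - {i}. gauss_moment (\<alpha> j + \<beta> j)))"
  proof (rule sum.cong[OF refl])
    fix i
    have "gauss_integral (vmon (?u i)) = gauss_moment (\<alpha> i - 2 + \<beta> i) * (\<Prod>j\<in>UNIV - {i}. gauss_moment (\<alpha> j + \<beta> j))"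
      unfolding gauss_integral_vmon by (subst prod.remove[of _ i]) (auto intro!: prod.cong)
    moreover have "gauss_integral (vmon ?v) = gauss_moment (\<alpha> i + \<beta> i) * (\<Prod>j\<in>UNIV - {i}. gauss_moment (\<alpha> j + \<beta> j))"
      unfolding gauss_integral_vmon by (subst prod.remove[of _ i]) auto
    ultimately show "?c i * gauss_integral (vmon (?u i)) + (- 2 * real (\<alpha> i)) * gauss_integral (vmon ?v) =
      (?c i * gauss_moment (\<alpha> i - 2 + \<beta> i) - 2 * real (\<alpha> i) * gauss_moment (\<alpha> i + \<beta> i))
       * (\<Prod>j\<in>UNIV - {i}. gauss_moment (\<alpha> j + \<beta> j))"
      by (simp add: algebra_simps)
  qed
  finally show ?thesis .
qed

lemma gauss_integral_hermite_op_sym: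
  "gauss_integral (\<lambda>x. hermite_op \<alpha> x * vmon \<beta> x) = gauss_integral (\<lambda>x. vmon \<alpha> x * hermite_op \<beta> x)"
proof -
  have "gauss_integral (\<lambda>x. vmon \<alpha> x * hermite_op \<beta> x) = gauss_integral (\<lambda>x. hermite_op \<beta> x * vmon \<alpha> x)"
    by (simp add: mult.commute)
  also have "\<dots> = gauss_integral (\<lambda>x. hermite_op \<alpha> x * vmon \<beta> x)"
    unfolding gauss_integral_hermite_op
  proof (rule sum.cong[OF refl])
    fix i
    show "(real (\<beta> i) * (real (\<beta> i) - 1) * gauss_moment (\<beta> i - 2 + \<alpha> i) - 2 * real (\<beta> i) * gauss_moment (\<beta> i + \<alpha> i))
        * (\<Prod>j\<in>UNIV - {i}. gauss_moment (\<beta> j + \<alpha> j)) =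
      (real (\<alpha> i) * (real (\<alpha> i) - 1) * gauss_moment (\<alpha> i - 2 + \<beta> i) - 2 * real (\<alpha> i) * gauss_moment (\<alpha> i + \<beta> i))
        * (\<Prod>j\<in>UNIV - {i}. gauss_moment (\<alpha> j + \<beta> j))"
      using gauss_moment_sym[of "\<beta> i" "\<alpha> i"] by (simp add: add.commute)
  qed
  finally show ?thesis by simp
qed

section \<open>Definiteness and the eigenvalue equation\<close>

text \<open>A zero integral only gives f = 0 almost everywhere; continuity upgrades this, because
  the set where f is nonzero is open and a negligible open set is empty.\<close>

lemma gauss_integral_square_eq_0:
  fixes f :: "real ^ 'd::finite \<Rightarrow> real"
  assumes f: "f \<in> polyd n" and 0: "gauss_integral (\<lambda>x. f x * f x) = 0"
  shows "f x = 0"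
proof -
  have cont: "continuous_on UNIV f" by (rule continuous_on_polyd[OF f])
  have "AE x in lborel. f x * f x * exp (- (norm x)\<^sup>2) = 0"
    using 0 gauss_integral_integrable[OF polyd_mult[OF f f]]
    by (subst integral_nonneg_eq_0_iff_AE[symmetric]) (auto simp: gauss_integral_def)
  then have "AE x in lborel. f x = 0" by simp
  then have "AE x in lebesgue. f x = 0"
    by (rule AE_completion)
  then have "negligible {x. f x \<noteq> 0}"
    by (auto simp: eventually_ae_filter_negligible intro: negligible_subset)
  moreover have "open {x. f x \<noteq> 0}"
    using cont by (intro open_Collect_neq) auto
  ultimately have "{x. f x \<noteq> 0} = {}"
    using open_not_negligible by blast
  then show ?thesis by blast
qed

lemma hermite_eigenfunction:
  fixes c :: "('d::finite \<Rightarrow> nat) \<Rightarrow> real" and n :: nat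
  defines "P \<equiv> (\<lambda>x. \<Sum>\<alpha> | sum \<alpha> UNIV \<le> n. c \<alpha> * vmon \<alpha> x)"
  assumes ortho: "\<And>m Q. m < n \<Longrightarrow> Q \<in> polyd m \<Longrightarrow> gauss_integral (\<lambda>x. P x * Q x) = 0"
  shows "(\<Sum>\<alpha> | sum \<alpha> UNIV \<le> n. c \<alpha> * hermite_op \<alpha> x) = - 2 * real n * P x"
proof (cases n)
  \<comment> \<open>Only the zero exponent occurs, and \<open>hermite_op\<close> kills constants.
    Treating it apart lets the remainder have degree m with n = Suc m.\<close>
  case 0
  then show ?thesis by (auto simp: hermite_op_def intro!: sum.neutral)
next
  case (Suc m)
  let ?A = "{\<alpha> :: 'd \<Rightarrow> nat. sum \<alpha> UNIV \<le> n}"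
  \<comment> \<open>Adding 2 n, the same constant for every \<alpha>, puts each
    \<open>T \<alpha>\<close> into degree at most m: top-degree monomials by cancellation, the
    others by their own degree.\<close>
  define T where "T \<alpha> x = hermite_op \<alpha> x + 2 * real n * vmon \<alpha> x" for \<alpha> and x :: "real ^ 'd"
  define R where "R x = (\<Sum>\<alpha>\<in>?A. c \<alpha> * T \<alpha> x)" for x
  have T: "T \<alpha> \<in> polyd m" if "\<alpha> \<in> ?A" for \<alpha>
    using hermite_op_add_in_polyd[of \<alpha> m] that by (simp add: T_def[abs_def] Suc)
  have R: "R \<in> polyd m"
    unfolding R_def[abs_def] by (intro polyd_sum polyd_cmult T)
  have sym: "gauss_integral (\<lambda>x. T \<alpha> x * vmon \<beta> x) = gauss_integral (\<lambda>x. vmon \<alpha> x * T \<beta> x)" for \<alpha> \<beta> :: "'d \<Rightarrow> nat"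
  proof -
    note m = polyd_mult[OF hermite_op_in_polyd[OF order_refl] vmon_in_polyd[OF order_refl]]
      polyd_mult[OF vmon_in_polyd[OF order_refl] hermite_op_in_polyd[OF order_refl]]
      polyd_cmult[OF polyd_mult[OF vmon_in_polyd[OF order_refl] vmon_in_polyd[OF order_refl]]]
    have "gauss_integral (\<lambda>x. T \<alpha> x * vmon \<beta> x) =
      gauss_integral (\<lambda>x. hermite_op \<alpha> x * vmon \<beta> x + 2 * real n * (vmon \<alpha> x * vmon \<beta> x))"
      by (simp add: T_def algebra_simps)
    also have "\<dots> = gauss_integral (\<lambda>x. vmon \<alpha> x * hermite_op \<beta> x + 2 * real n * (vmon \<alpha> x * vmon \<beta> x))"
      using gauss_integral_add[OF m(1,3), of \<alpha> \<beta> "2 * real n" \<alpha> \<beta>] gauss_integral_add[OF m(2,3), of \<alpha> \<beta> "2 * real n" \<alpha> \<beta>]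
      by (simp only: gauss_integral_hermite_op_sym)
    also have "\<dots> = gauss_integral (\<lambda>x. vmon \<alpha> x * T \<beta> x)"
      by (simp add: T_def algebra_simps)
    finally show ?thesis .
  qed
  \<comment> \<open>Symmetry moves the operator from the monomials of \<open>P\<close> onto the test
    monomial; \<open>T \<beta>\<close> still has degree at most m < n, so the orthogonality of
    \<open>P\<close> applies.\<close>
  have orth: "gauss_integral (\<lambda>x. R x * vmon \<beta> x) = 0" if \<beta>: "sum \<beta> UNIV \<le> m" for \<beta>
  proof -
    have T\<beta>: "T \<beta> \<in> polyd m" using T \<beta> Suc by auto
    have "gauss_integral (\<lambda>x. R x * vmon \<beta> x) = gauss_integral (\<lambda>x. \<Sum>\<alpha>\<in>?A. c \<alpha> * (T \<alpha> x * vmon \<beta> x))"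
      by (simp add: R_def sum_distrib_right mult.assoc)
    also have "\<dots> = (\<Sum>\<alpha>\<in>?A. gauss_integral (\<lambda>x. c \<alpha> * (T \<alpha> x * vmon \<beta> x)))"
      by (rule gauss_integral_sum[where n = "m + m"]) (intro polyd_cmult polyd_mult T vmon_in_polyd \<beta>)
    also have "\<dots> = (\<Sum>\<alpha>\<in>?A. gauss_integral (\<lambda>x. c \<alpha> * (vmon \<alpha> x * T \<beta> x)))"
      by (simp add: gauss_integral_cmult sym)
    also have "\<dots> = gauss_integral (\<lambda>x. \<Sum>\<alpha>\<in>?A. c \<alpha> * (vmon \<alpha> x * T \<beta> x))"
      by (rule gauss_integral_sum[symmetric, where n = "n + m"]) (intro polyd_cmult polyd_mult T\<beta> vmon_in_polyd, simp)
    also have "\<dots> = gauss_integral (\<lambda>x. P x * T \<beta> x)"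
      by (simp add: P_def sum_distrib_right mult.assoc)
    also have "\<dots> = 0"
      using ortho T\<beta> Suc by blast
    finally show ?thesis .
  qed
  obtain e where e: "R = (\<lambda>x. \<Sum>\<beta> | sum \<beta> UNIV \<le> m. e \<beta> * vmon \<beta> x)"
    using R by (rule polydE)
  have "gauss_integral (\<lambda>x. R x * R x) = gauss_integral (\<lambda>x. \<Sum>\<beta> | sum \<beta> UNIV \<le> m. e \<beta> * (R x * vmon \<beta> x))"
    \<comment> \<open>Only one factor R is expanded; the other must stay intact for
      \<open>orth\<close> to apply termwise.\<close>
    by (subst (2) e) (simp add: sum_distrib_left mult_ac)
  also have "\<dots> = (\<Sum>\<beta> | sum \<beta> UNIV \<le> m. gauss_integral (\<lambda>x. e \<beta> * (R x * vmon \<beta> x)))"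
    by (rule gauss_integral_sum[where n = "m + m"]) (intro polyd_cmult polyd_mult R vmon_in_polyd, simp)
  also have "\<dots> = 0"
    by (simp add: gauss_integral_cmult orth)
  finally have "R x = 0"
    by (rule gauss_integral_square_eq_0[OF R])
  moreover have "R x = (\<Sum>\<alpha>\<in>?A. c \<alpha> * hermite_op \<alpha> x) + 2 * real n * P x"
    by (simp add: R_def T_def P_def distrib_left sum.distrib sum_distrib_left mult_ac)
  ultimately show ?thesis by linarith
qed

section \<open>The inner product on the hyperboloid\<close>

lemma square_powr_neg_half:
  assumes r: "r > (0::real)"
  shows "(r\<^sup>2) powr (- 1 / 2) = 1 / r"
proof -
  have "(r\<^sup>2) powr (- (1 / 2)) = inverse (sqrt (r\<^sup>2))"
    by (simp only: powr_minus powr_half_sqrt zero_le_power2)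
  also have "\<dots> = 1 / r"
    using r by (simp add: divide_inverse)
  finally show ?thesis by (simp only: minus_divide_left)
qed

text \<open>Here \<open>p\<close> and \<open>q\<close> are compared with \<open>P\<close> and
  \<open>Q\<close> only on the hyperboloid, where t^2 = |x|^2 + \<rho>^2 makes the weight a function
  of |x|.\<close>

lemma hyperboloid_inner_w0:
  fixes p q :: "(real ^ 'd::finite) \<times> real \<Rightarrow> real"
  assumes \<rho>: "\<rho> > 0" and P: "P \<in> polyd m" and Q: "Q \<in> polyd n"
    and p: "\<And>x t. (x, t) \<in> double_hyperboloid \<rho> \<Longrightarrow> p (x, t) = P x"
    and q: "\<And>x t. (x, t) \<in> double_hyperboloid \<rho> \<Longrightarrow> q (x, t) = Q x"
  shows "hyperboloid_inner \<rho> (w0 \<rho>) p q = 2 * exp (- \<rho>\<^sup>2) * gauss_integral (\<lambda>x. P x * Q x)"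
proof -
  let ?d = "CARD('d)"
  define F where "F x = P x * Q x * exp (- (norm x)\<^sup>2)" for x
  define G where "G r = (LINT \<xi>|sphere_measure. F (r *\<^sub>R \<xi>))" for r
  define f where "f r = exp (- \<rho>\<^sup>2) * (r ^ (?d - 1) * G r)" for r
  have F: "integrable lborel F"
    using gauss_integral_integrable[OF polyd_mult[OF P Q]] by (simp add: F_def[abs_def])
  have G [measurable]: "G \<in> borel_measurable borel"
    unfolding G_def[abs_def] by (rule sphere_measure_integral_measurable) (use F in simp)
  have [measurable]: "f \<in> borel_measurable borel"
    unfolding f_def[abs_def] by measurable
  have f: "set_integrable lborel {0<..} f"
    unfolding f_def[abs_def] G_def by (intro set_integrable_mult_right impI polar_coordinates(1) F)
  have fint: "(LINT r:{0<..}|lborel. f r) = exp (- \<rho>\<^sup>2) * gauss_integral (\<lambda>x. P x * Q x)"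
    using polar_coordinates(2)[OF F] by (simp add: f_def G_def gauss_integral_def F_def)
  have main: "(t\<^sup>2 - \<rho>\<^sup>2) powr ((real ?d - 1) / 2) *
        (LINT \<xi>|sphere_measure. p (sqrt (t\<^sup>2 - \<rho>\<^sup>2) *\<^sub>R \<xi>, t) * q (sqrt (t\<^sup>2 - \<rho>\<^sup>2) *\<^sub>R \<xi>, t) * w0 \<rho> t)
      = \<bar>t\<bar> / sqrt (t\<^sup>2 - \<rho>\<^sup>2) * f (sqrt (t\<^sup>2 - \<rho>\<^sup>2))" if t: "\<bar>t\<bar> > \<rho>" for t
  proof -
    define r where "r = sqrt (t\<^sup>2 - \<rho>\<^sup>2)"
    have "t\<^sup>2 - \<rho>\<^sup>2 > 0" using power_strict_mono[OF t, of 2] \<rho> by simp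
    then have r: "r > 0" "t\<^sup>2 - \<rho>\<^sup>2 = r\<^sup>2" by (simp_all add: r_def)
    have w: "w0 \<rho> t = \<bar>t\<bar> / r * exp (- \<rho>\<^sup>2) * exp (- r\<^sup>2)"
    proof -
      have "(r\<^sup>2) powr (- 1 / 2) = 1 / r"
        by (rule square_powr_neg_half[OF r(1)])
      moreover have "- t\<^sup>2 = - \<rho>\<^sup>2 + - r\<^sup>2" using r(2) by linarith
      then have "exp (- t\<^sup>2) = exp (- \<rho>\<^sup>2) * exp (- r\<^sup>2)"
        by (simp only: exp_add)
      ultimately show ?thesis by (simp only: w0_def r(2)) (simp add: mult_ac)
    qed
    \<comment> \<open>The real power in the surface element is the radial density r^(d-1) of polar
      coordinates.\<close>
    have c: "(r\<^sup>2) powr ((real ?d - 1) / 2) = r ^ (?d - 1)"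
    proof -
      have "(r\<^sup>2) powr ((real ?d - 1) / 2) = (r powr 2) powr ((real ?d - 1) / 2)"
        using r(1) by (simp add: powr_numeral)
      also have "\<dots> = r powr real (?d - 1)"
        unfolding powr_powr by (rule arg_cong[where f = "(powr) r"]) (simp add: of_nat_diff Suc_leI)
      also have "\<dots> = r ^ (?d - 1)" using r(1) by (rule powr_realpow)
      finally show ?thesis .
    qed
    have "(LINT \<xi>|sphere_measure. p (r *\<^sub>R \<xi>, t) * q (r *\<^sub>R \<xi>, t) * w0 \<rho> t) =
        (LINT \<xi>|sphere_measure. (\<bar>t\<bar> / r * exp (- \<rho>\<^sup>2)) * F (r *\<^sub>R \<xi>))"
    proof (rule Bochner_Integration.integral_cong[OF refl])
      fix \<xi> :: "real ^ 'd" assume "\<xi> \<in> space sphere_measure"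
      then have \<xi>: "norm \<xi> = 1" by (simp add: space_sphere_measure)
      have "(r *\<^sub>R \<xi>, t) \<in> double_hyperboloid \<rho>"
        using t r \<xi> by (simp add: double_hyperboloid_def power_mult_distrib)
      then show "p (r *\<^sub>R \<xi>, t) * q (r *\<^sub>R \<xi>, t) * w0 \<rho> t = (\<bar>t\<bar> / r * exp (- \<rho>\<^sup>2)) * F (r *\<^sub>R \<xi>)"
        using r(1) by (simp add: p q w F_def \<xi> power_mult_distrib)
    qed
    also have "\<dots> = (\<bar>t\<bar> / r * exp (- \<rho>\<^sup>2)) * G r"
      unfolding G_def by simp
    finally show ?thesis
      unfolding r_def[symmetric] unfolding r(2) c by (simp add: f_def)
  qed
  have "hyperboloid_inner \<rho> (w0 \<rho>) p q = (LINT t|lborel. indicator {t. \<bar>t\<bar> \<ge> \<rho>} t *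
      (\<bar>t\<bar> / sqrt (t\<^sup>2 - \<rho>\<^sup>2) * f (sqrt (t\<^sup>2 - \<rho>\<^sup>2))))"
    unfolding hyperboloid_inner_def hyperboloid_integral_def set_lebesgue_integral_def
  proof (rule Bochner_Integration.integral_cong[OF refl])
    fix t :: real
    consider "\<bar>t\<bar> < \<rho>" | "\<bar>t\<bar> = \<rho>" | "\<bar>t\<bar> > \<rho>" by linarith
    then show "indicator {t. \<bar>t\<bar> \<ge> \<rho>} t *\<^sub>R ((t\<^sup>2 - \<rho>\<^sup>2) powr ((real ?d - 1) / 2) *
        (LINT \<xi>|sphere_measure. (case (sqrt (t\<^sup>2 - \<rho>\<^sup>2) *\<^sub>R \<xi>, t) of (x, t) \<Rightarrow> p (x, t) * q (x, t) * w0 \<rho> t)))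
      = indicator {t. \<bar>t\<bar> \<ge> \<rho>} t * (\<bar>t\<bar> / sqrt (t\<^sup>2 - \<rho>\<^sup>2) * f (sqrt (t\<^sup>2 - \<rho>\<^sup>2)))"
    proof cases
      \<comment> \<open>On the boundary both sides are 0 by convention: \<open>0 powr _\<close> is 0
        on the left, and division by \<open>sqrt 0\<close> gives 0 on the right.\<close>
      case 2
      then have "t\<^sup>2 = \<rho>\<^sup>2" by (metis power2_abs)
      then show ?thesis by simp
    qed (use main in auto)
  qed
  also have "\<dots> = 2 * (LINT r:{0<..}|lborel. f r)"
    using hyperboloid_coordinate_change[OF \<rho> f] by (simp add: has_bochner_integral_iff)
  finally show ?thesis by (simp add: fint)
qed

section \<open>The operator in hyperboloid coordinates\<close>

text \<open>A second \<open>deriv\<close> needs the first one on a whole neighbourhood. This allows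
  \<open>f\<close> to be known only on the open set \<open>S\<close>, as happens for restrictions to
  the hyperboloid and for normalised points.\<close>

lemma deriv_eq_on_open:
  fixes f h h' :: "real \<Rightarrow> real"
  assumes S: "open S" "t \<in> S" and fh: "\<And>s. s \<in> S \<Longrightarrow> f s = h s"
    and h: "\<And>s. s \<in> S \<Longrightarrow> (h has_field_derivative h' s) (at s)"
    and h': "(h' has_field_derivative D) (at t)"
  shows "deriv f t = h' t" and "(deriv ^^ 2) f t = D"
proof -
  have 1: "deriv f s = h' s" if "s \<in> S" for s
    by (rule DERIV_imp_deriv, rule has_field_derivative_transform_within_open[OF h[OF that] S(1) that])
       (simp add: fh)
  show "deriv f t = h' t" by (rule 1[OF S(2)])
  have "(deriv f has_field_derivative D) (at t)"
    by (rule has_field_derivative_transform_within_open[OF h' S]) (simp add: 1)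
  then show "(deriv ^^ 2) f t = D"
    by (simp add: numeral_2_eq_2 DERIV_imp_deriv)
qed

text \<open>Real exponents are used because |x|^k = (s^2 - \<rho>^2) powr (k/2) then differentiates
  by one rule for all k, odd and small ones included.\<close>

lemma radial_derivatives:
  fixes \<rho> a :: real
  assumes s: "\<bar>s\<bar> > \<rho>" "\<rho> > 0"
  shows "((\<lambda>s. (s\<^sup>2 - \<rho>\<^sup>2) powr a) has_field_derivative 2 * a * s * (s\<^sup>2 - \<rho>\<^sup>2) powr (a - 1)) (at s)"
    and "((\<lambda>s. 2 * a * s * (s\<^sup>2 - \<rho>\<^sup>2) powr (a - 1)) has_field_derivative
       2 * a * (s\<^sup>2 - \<rho>\<^sup>2) powr (a - 1) + 4 * a * (a - 1) * s\<^sup>2 * (s\<^sup>2 - \<rho>\<^sup>2) powr (a - 2)) (at s)"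
proof -
  have pos: "s\<^sup>2 - \<rho>\<^sup>2 > 0" using power_strict_mono[OF s(1), of 2] s(2) by simp
  have q: "((\<lambda>s. s\<^sup>2 - \<rho>\<^sup>2) has_field_derivative 2 * s) (at s)"
    by (auto intro!: derivative_eq_intros)
  have p: "((\<lambda>s. (s\<^sup>2 - \<rho>\<^sup>2) powr b) has_field_derivative 2 * b * s * (s\<^sup>2 - \<rho>\<^sup>2) powr (b - 1)) (at s)" for b
    using DERIV_fun_powr[OF q pos, of b] by (simp add: mult_ac)
  show "((\<lambda>s. (s\<^sup>2 - \<rho>\<^sup>2) powr a) has_field_derivative 2 * a * s * (s\<^sup>2 - \<rho>\<^sup>2) powr (a - 1)) (at s)"
    by (rule p)
  have l: "((\<lambda>s. 2 * a * s) has_field_derivative 2 * a) (at s)"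
    by (auto intro!: derivative_eq_intros)
  show "((\<lambda>s. 2 * a * s * (s\<^sup>2 - \<rho>\<^sup>2) powr (a - 1)) has_field_derivative
       2 * a * (s\<^sup>2 - \<rho>\<^sup>2) powr (a - 1) + 4 * a * (a - 1) * s\<^sup>2 * (s\<^sup>2 - \<rho>\<^sup>2) powr (a - 2)) (at s)"
    using DERIV_mult[OF l p[of "a - 1"]] by (simp add: algebra_simps power2_eq_square)
qed

text \<open>Here \<open>r\<close> is the squared radius and k the degree, so the right-hand side is
  the radial part of the Laplacian minus twice the Euler operator on |x|^k. The constant k (k + d -
  2) is the one that the sphere Laplacian produces with opposite sign.\<close>

lemma radial_operator:
  fixes \<rho> a k d t :: real
  assumes t: "\<bar>t\<bar> > \<rho>" "\<rho> > 0" and k: "k = 2 * a"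
  defines "r \<equiv> t\<^sup>2 - \<rho>\<^sup>2"
  defines "D1 \<equiv> 2 * a * t * r powr (a - 1)"
  defines "D2 \<equiv> 2 * a * r powr (a - 1) + 4 * a * (a - 1) * t\<^sup>2 * r powr (a - 2)"
  shows "(1 - \<rho>\<^sup>2 / t\<^sup>2) * D2 + (\<rho>\<^sup>2 / t\<^sup>2 - 2 * r) * (1 / t) * D1 + (d - 1) / t * D1
    = k * (k + d - 2) * (r powr a / r) - 2 * k * r powr a"
proof -
  have pos: "r > 0" using power_strict_mono[OF t(1), of 2] t(2) by (simp add: r_def)
  have t0: "t \<noteq> 0" using t by auto
  \<comment> \<open>The lowest power that occurs; in terms of it the claim becomes a rational
    identity in t and r.\<close>
  define X where "X = r powr (a - 2)"
  have X: "r powr (a - 1) = r * X" "r powr a = r * r * X"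
    using pos powr_add[of r 1 "a - 2"] powr_add[of r 2 "a - 2"]
    by (simp_all add: X_def powr_numeral power2_eq_square)
  have \<rho>: "\<rho>\<^sup>2 = t\<^sup>2 - r" by (simp add: r_def)
  show ?thesis
    unfolding D1_def D2_def X X_def[symmetric] \<rho> k using t0 pos
    by (simp add: field_simps power2_eq_square)
qed

section \<open>The Laplace-Beltrami operator on monomials\<close>

lemma vmon_line:
  "vmon \<alpha> (\<xi> + s *\<^sub>R axis i 1) = (\<xi> $ i + s) ^ \<alpha> i * (\<Prod>j\<in>UNIV - {i}. \<xi> $ j ^ \<alpha> j)"
  by (subst vmon_split[of _ _ i]) (auto simp: axis_def intro!: prod.cong)

lemma norm_line:
  fixes \<xi> :: "real ^ 'd::finite"
  assumes "norm \<xi> = 1"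
  shows "(norm (\<xi> + s *\<^sub>R axis i 1))\<^sup>2 = 1 + 2 * s * \<xi> $ i + s\<^sup>2"
proof -
  have "(norm (\<xi> + s *\<^sub>R axis i 1))\<^sup>2 = (norm \<xi>)\<^sup>2 + 2 * (s * (\<xi> \<bullet> axis i 1)) + s\<^sup>2 * (axis i 1 \<bullet> (axis i 1 :: real ^ 'd))"
    unfolding power2_norm_eq_inner by (simp add: inner_add_left inner_add_right inner_commute power2_eq_square)
  then show ?thesis using assms by (simp add: inner_axis inner_axis_axis)
qed

lemma norm_line_pos:
  fixes \<xi> :: "real ^ 'd::finite"
  assumes \<xi>: "norm \<xi> = 1" and s: "\<bar>s\<bar> < 1"
  shows "0 < norm (\<xi> + s *\<^sub>R axis i 1)"
proof -
  have "norm \<xi> - norm (- (s *\<^sub>R axis i 1 :: real ^ 'd)) \<le> norm (\<xi> - (- (s *\<^sub>R axis i 1)))"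
    by (rule norm_triangle_ineq2)
  then have "1 - \<bar>s\<bar> \<le> norm (\<xi> + s *\<^sub>R axis i 1)" using \<xi> by simp
  then show ?thesis using s by linarith
qed

text \<open>Expressed through the squared norm because along a coordinate line this is the quadratic
  of \<open>norm_line\<close>, which can be differentiated without square roots.\<close>

lemma vmon_normalized:
  assumes "x \<noteq> 0"
  shows "vmon \<alpha> (x /\<^sub>R norm x) = vmon \<alpha> x * ((norm x)\<^sup>2) powr (- real (sum \<alpha> UNIV) / 2)"
proof -
  have "((norm x)\<^sup>2) powr (- real (sum \<alpha> UNIV) / 2) = ((norm x) powr 2) powr (- real (sum \<alpha> UNIV) / 2)"
    using assms by (simp add: powr_numeral)
  also have "\<dots> = inverse (norm x) ^ sum \<alpha> UNIV"
    using assms unfolding powr_powr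
    by (simp add: powr_minus powr_realpow power_inverse del: of_nat_sum)
  finally show ?thesis by (simp add: vmon_scaleR)
qed

text \<open>For x = \<xi> $ i the quadratic is the squared norm of \<xi> + s e_i, \<open>w\<close>
  stands for the product over the other coordinates, and b will be - |\<alpha>| / 2.\<close>

lemma line_derivatives:
  fixes x w b s :: real and m :: nat
  assumes pos: "1 + 2 * s * x + s\<^sup>2 > 0"
  shows "((\<lambda>s. (x + s) ^ m * w * (1 + 2 * s * x + s\<^sup>2) powr b) has_field_derivative
      real m * (x + s) ^ (m - 1) * w * (1 + 2 * s * x + s\<^sup>2) powr b
      + (x + s) ^ m * w * (b * (2 * x + 2 * s) * (1 + 2 * s * x + s\<^sup>2) powr (b - 1))) (at s)"
proof -
  have q: "((\<lambda>s. 1 + 2 * s * x + s\<^sup>2) has_field_derivative 2 * x + 2 * s) (at s)"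
    by (auto intro!: derivative_eq_intros)
  have p: "((\<lambda>s. (1 + 2 * s * x + s\<^sup>2) powr b) has_field_derivative
       b * (2 * x + 2 * s) * (1 + 2 * s * x + s\<^sup>2) powr (b - 1)) (at s)"
    using DERIV_fun_powr[OF q pos, of b] by (simp add: mult_ac)
  have l: "((\<lambda>s. (x + s) ^ m * w) has_field_derivative real m * (x + s) ^ (m - 1) * w) (at s)"
    by (auto intro!: derivative_eq_intros)
  show ?thesis
    using DERIV_mult[OF l p] by (simp add: mult_ac add_ac)
qed

lemma line_second_derivative:
  fixes x w b :: real and m :: nat
  shows "((\<lambda>s. real m * (x + s) ^ (m - 1) * w * (1 + 2 * s * x + s\<^sup>2) powr b
      + (x + s) ^ m * w * (b * (2 * x + 2 * s) * (1 + 2 * s * x + s\<^sup>2) powr (b - 1))) has_field_derivative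
      real m * (real m - 1) * x ^ (m - 2) * w + x ^ m * w * (4 * real m * b + 4 * b * (b - 1) * x\<^sup>2 + 2 * b)) (at 0)"
proof -
  have pos: "1 + 2 * 0 * x + 0\<^sup>2 > (0::real)" by simp
  have l: "((\<lambda>s. 2 * b * (x + s)) has_field_derivative 2 * b) (at 0)"
    by (auto intro!: derivative_eq_intros)
  have m1: "real m * (real (m - 1) * x ^ (m - 1 - 1)) = real m * (real m - 1) * x ^ (m - 2)"
    by (cases m) (auto simp: numeral_2_eq_2)
  have m2: "real m * x ^ (m - 1) * x = real m * x ^ m"
    by (cases m) auto
  note A = DERIV_cmult[OF line_derivatives[OF pos, of "m - 1" w b], of "real m"]
  note B = DERIV_mult[OF l line_derivatives[OF pos, of m w "b - 1"]]
  \<comment> \<open>Regroups the first derivative into two functions of the shape already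
    differentiated, with parameters (m - 1, b) and (m, b - 1).\<close>
  have e: "(\<lambda>s. real m * (x + s) ^ (m - 1) * w * (1 + 2 * s * x + s\<^sup>2) powr b
      + (x + s) ^ m * w * (b * (2 * x + 2 * s) * (1 + 2 * s * x + s\<^sup>2) powr (b - 1))) =
    (\<lambda>s. real m * ((x + s) ^ (m - 1) * w * (1 + 2 * s * x + s\<^sup>2) powr b)
      + 2 * b * (x + s) * ((x + s) ^ m * w * (1 + 2 * s * x + s\<^sup>2) powr (b - 1)))"
    by (simp add: algebra_simps)
  have v: "real m * (real (m - 1) * (x + 0) ^ (m - 1 - 1) * w * (1 + 2 * 0 * x + 0\<^sup>2) powr b
       + (x + 0) ^ (m - 1) * w * (b * (2 * x + 2 * 0) * (1 + 2 * 0 * x + 0\<^sup>2) powr (b - 1)))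
      + (2 * b * ((x + 0) ^ m * w * (1 + 2 * 0 * x + 0\<^sup>2) powr (b - 1))
       + (real m * (x + 0) ^ (m - 1) * w * (1 + 2 * 0 * x + 0\<^sup>2) powr (b - 1)
         + (x + 0) ^ m * w * ((b - 1) * (2 * x + 2 * 0) * (1 + 2 * 0 * x + 0\<^sup>2) powr (b - 1 - 1))) * (2 * b * (x + 0)))
    = real m * (real m - 1) * x ^ (m - 2) * w + x ^ m * w * (4 * real m * b + 4 * b * (b - 1) * x\<^sup>2 + 2 * b)"
    (is "?l = _")
  proof -
    have "?l = (real m * (real (m - 1) * x ^ (m - 1 - 1))) * w + (real m * x ^ (m - 1) * x) * w * (4 * b)
        + x ^ m * w * (2 * b + 4 * b * (b - 1) * x\<^sup>2)"
      by (simp add: algebra_simps power2_eq_square)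
    then show ?thesis unfolding m1 m2 by (simp add: algebra_simps)
  qed
  show ?thesis
    unfolding e v[symmetric] by (rule DERIV_add[OF A B])
qed

text \<open>The extension constant along rays is a monomial times |x|^(-k). Summing over i with sum
  \<alpha> = k and |\<xi>| = 1 gives the coefficient - 2 k^2 + (k^2 + 2 k) - d k = - k (k + d -
  2).\<close>

lemma sphere_laplacian_vmon_sum:
  fixes \<xi> :: "real ^ 'd::finite" and c :: "('d \<Rightarrow> nat) \<Rightarrow> real"
  assumes \<xi>: "norm \<xi> = 1" and A: "finite A"
    and f: "\<And>\<eta>. norm \<eta> = 1 \<Longrightarrow> f \<eta> = (\<Sum>\<alpha>\<in>A. c \<alpha> * vmon \<alpha> \<eta>)"
  shows "sphere_laplacian f \<xi> = (\<Sum>\<alpha>\<in>A. c \<alpha> *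
     ((\<Sum>i\<in>UNIV. real (\<alpha> i) * (real (\<alpha> i) - 1) * vmon (\<alpha>(i := \<alpha> i - 2)) \<xi>)
       - real (sum \<alpha> UNIV) * (real (sum \<alpha> UNIV) + real CARD('d) - 2) * vmon \<alpha> \<xi>))"
proof -
  let ?b = "\<lambda>\<alpha>::'d \<Rightarrow> nat. - real (sum \<alpha> UNIV) / 2"
  let ?w = "\<lambda>\<alpha> i. \<Prod>j\<in>UNIV - {i}. \<xi> $ j ^ \<alpha> j"
  let ?q = "\<lambda>i s. 1 + 2 * s * \<xi> $ i + s\<^sup>2"
  \<comment> \<open>For |s| < 1 the line through the unit vector \<xi> stays away from the origin,
    where normalisation breaks down.\<close>
  have eq: "f ((\<xi> + s *\<^sub>R axis i 1) /\<^sub>R norm (\<xi> + s *\<^sub>R axis i 1)) =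
      (\<Sum>\<alpha>\<in>A. c \<alpha> * ((\<xi> $ i + s) ^ \<alpha> i * ?w \<alpha> i * ?q i s powr ?b \<alpha>))" if "s \<in> {-1<..<1}" for s i
  proof -
    have "norm (\<xi> + s *\<^sub>R axis i 1) > 0"
      using norm_line_pos[OF \<xi>, of s i] that by (simp add: abs_less_iff)
    then show ?thesis
      by (subst f) (auto simp: vmon_normalized norm_line[OF \<xi>] vmon_line)
  qed
  have pos: "?q i s > 0" if "s \<in> {-1<..<1}" for i s
    using norm_line_pos[OF \<xi>, of s i] norm_line[OF \<xi>, of s i] that
    by (metis abs_less_iff greaterThanLessThan_iff minus_less_iff zero_less_power)
  let ?D = "\<lambda>\<alpha> i. real (\<alpha> i) * (real (\<alpha> i) - 1) * \<xi> $ i ^ (\<alpha> i - 2) * ?w \<alpha> i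
    + \<xi> $ i ^ \<alpha> i * ?w \<alpha> i * (4 * real (\<alpha> i) * ?b \<alpha> + 4 * ?b \<alpha> * (?b \<alpha> - 1) * (\<xi> $ i)\<^sup>2 + 2 * ?b \<alpha>)"
  have d2: "(deriv ^^ 2) (\<lambda>s. f ((\<xi> + s *\<^sub>R axis i 1) /\<^sub>R norm (\<xi> + s *\<^sub>R axis i 1))) 0 = (\<Sum>\<alpha>\<in>A. c \<alpha> * ?D \<alpha> i)" for i
  proof (rule deriv_eq_on_open(2)[where S = "{-1<..<1}", OF _ _ eq])
    show "((\<lambda>s. \<Sum>\<alpha>\<in>A. c \<alpha> * ((\<xi> $ i + s) ^ \<alpha> i * ?w \<alpha> i * ?q i s powr ?b \<alpha>)) has_field_derivative
      (\<Sum>\<alpha>\<in>A. c \<alpha> * (real (\<alpha> i) * (\<xi> $ i + s) ^ (\<alpha> i - 1) * ?w \<alpha> i * ?q i s powr ?b \<alpha>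
      + (\<xi> $ i + s) ^ \<alpha> i * ?w \<alpha> i * (?b \<alpha> * (2 * \<xi> $ i + 2 * s) * ?q i s powr (?b \<alpha> - 1))))) (at s)"
      if "s \<in> {-1<..<1}" for s
      by (intro DERIV_sum DERIV_cmult line_derivatives pos that)
    show "((\<lambda>s. \<Sum>\<alpha>\<in>A. c \<alpha> * (real (\<alpha> i) * (\<xi> $ i + s) ^ (\<alpha> i - 1) * ?w \<alpha> i * ?q i s powr ?b \<alpha>
      + (\<xi> $ i + s) ^ \<alpha> i * ?w \<alpha> i * (?b \<alpha> * (2 * \<xi> $ i + 2 * s) * ?q i s powr (?b \<alpha> - 1)))) has_field_derivative
      (\<Sum>\<alpha>\<in>A. c \<alpha> * ?D \<alpha> i)) (at 0)"
      by (intro DERIV_sum DERIV_cmult line_second_derivative)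
  qed auto
  then have "sphere_laplacian f \<xi> = (\<Sum>i\<in>UNIV. \<Sum>\<alpha>\<in>A. c \<alpha> * ?D \<alpha> i)"
    unfolding sphere_laplacian_def laplacian_def by simp
  also have "\<dots> = (\<Sum>\<alpha>\<in>A. c \<alpha> * (\<Sum>i\<in>UNIV. ?D \<alpha> i))"
    by (subst sum.swap) (simp add: sum_distrib_left)
  also have "\<dots> = (\<Sum>\<alpha>\<in>A. c \<alpha> *
     ((\<Sum>i\<in>UNIV. real (\<alpha> i) * (real (\<alpha> i) - 1) * vmon (\<alpha>(i := \<alpha> i - 2)) \<xi>)
       - real (sum \<alpha> UNIV) * (real (sum \<alpha> UNIV) + real CARD('d) - 2) * vmon \<alpha> \<xi>))"
  proof (intro sum.cong refl arg_cong2[where f = "(*)"])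
    fix \<alpha> :: "'d \<Rightarrow> nat"
    let ?k = "real (sum \<alpha> UNIV)"
    have n: "(\<Sum>i\<in>UNIV. (\<xi> $ i)\<^sup>2) = 1"
      using \<xi> by (simp add: norm_vec_def L2_set_def)
    have 1: "?D \<alpha> i = real (\<alpha> i) * (real (\<alpha> i) - 1) * vmon (\<alpha>(i := \<alpha> i - 2)) \<xi>
        + (4 * ?b \<alpha> * vmon \<alpha> \<xi>) * real (\<alpha> i) + (4 * ?b \<alpha> * (?b \<alpha> - 1) * vmon \<alpha> \<xi>) * (\<xi> $ i)\<^sup>2 + 2 * ?b \<alpha> * vmon \<alpha> \<xi>" for i
    proof -
      have "vmon (\<alpha>(i := \<alpha> i - 2)) \<xi> = \<xi> $ i ^ (\<alpha> i - 2) * ?w \<alpha> i"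
        by (subst vmon_split[of _ _ i]) (auto intro!: prod.cong)
      moreover have "vmon \<alpha> \<xi> = \<xi> $ i ^ \<alpha> i * ?w \<alpha> i"
        by (rule vmon_split)
      moreover have "a * (a - 1) * X * W + Y * W * (4 * a * b + 4 * b * (b - 1) * q + 2 * b) =
          a * (a - 1) * (X * W) + 4 * b * (Y * W) * a + 4 * b * (b - 1) * (Y * W) * q + 2 * b * (Y * W)"
        for a b q X Y W :: real
        by (simp add: algebra_simps)
      ultimately show ?thesis by (simp only:)
    qed
    have "(\<Sum>i\<in>UNIV. ?D \<alpha> i) = (\<Sum>i\<in>UNIV. real (\<alpha> i) * (real (\<alpha> i) - 1) * vmon (\<alpha>(i := \<alpha> i - 2)) \<xi>)
        + (4 * ?b \<alpha> * vmon \<alpha> \<xi>) * (\<Sum>i\<in>UNIV. real (\<alpha> i)) + (4 * ?b \<alpha> * (?b \<alpha> - 1) * vmon \<alpha> \<xi>) * (\<Sum>i\<in>UNIV. (\<xi> $ i)\<^sup>2)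
        + real CARD('d) * (2 * ?b \<alpha> * vmon \<alpha> \<xi>)"
      unfolding 1 sum.distrib sum_distrib_left[symmetric] by simp
    also have "(\<Sum>i\<in>UNIV. real (\<alpha> i)) = ?k" by simp
    also note n
    also have "S + (4 * (- k / 2) * m) * k + (4 * (- k / 2) * (- k / 2 - 1) * m) * 1 + d * (2 * (- k / 2) * m)
        = S - k * (k + d - 2) * m" for S k m d :: real
      by (simp add: field_simps)
    finally show "(\<Sum>i\<in>UNIV. ?D \<alpha> i) = (\<Sum>i\<in>UNIV. real (\<alpha> i) * (real (\<alpha> i) - 1) * vmon (\<alpha>(i := \<alpha> i - 2)) \<xi>)
       - ?k * (?k + real CARD('d) - 2) * vmon \<alpha> \<xi>"
      .
  qed
  finally show ?thesis .
qed

text \<open>The two parts are homogeneous of degrees |\<alpha>| - 2 and |\<alpha>|; dividing by r^2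
  keeps the formula uniform, since exponents below 2 have coefficient zero.\<close>

lemma hermite_op_scaleR:
  assumes "r > 0"
  shows "hermite_op \<alpha> (r *\<^sub>R \<xi>) = r ^ sum \<alpha> UNIV *
    ((\<Sum>i\<in>UNIV. real (\<alpha> i) * (real (\<alpha> i) - 1) * vmon (\<alpha>(i := \<alpha> i - 2)) \<xi>) / r\<^sup>2
      - 2 * real (sum \<alpha> UNIV) * vmon \<alpha> \<xi>)"
proof -
  have "real (\<alpha> i) * (real (\<alpha> i) - 1) * vmon (\<alpha>(i := \<alpha> i - 2)) (r *\<^sub>R \<xi>) =
      r ^ sum \<alpha> UNIV / r\<^sup>2 * (real (\<alpha> i) * (real (\<alpha> i) - 1) * vmon (\<alpha>(i := \<alpha> i - 2)) \<xi>)" for i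
  proof (cases "\<alpha> i \<ge> 2")
    case True
    then have "sum \<alpha> UNIV = sum (\<alpha>(i := \<alpha> i - 2)) UNIV + 2"
      using sum_fun_upd_UNIV[of \<alpha> i "\<alpha> i - 2"] by linarith
    then have "r ^ sum (\<alpha>(i := \<alpha> i - 2)) UNIV = r ^ sum \<alpha> UNIV / r\<^sup>2"
      using assms by (simp add: field_simps power2_eq_square del: fun_upd_apply)
    then show ?thesis unfolding vmon_scaleR by simp
  next
    case False
    then have "\<alpha> i = 0 \<or> \<alpha> i = 1" by linarith
    then show ?thesis by auto
  qed
  then have S: "(\<Sum>i\<in>UNIV. real (\<alpha> i) * (real (\<alpha> i) - 1) * vmon (\<alpha>(i := \<alpha> i - 2)) (r *\<^sub>R \<xi>)) =
      r ^ sum \<alpha> UNIV / r\<^sup>2 * (\<Sum>i\<in>UNIV. real (\<alpha> i) * (real (\<alpha> i) - 1) * vmon (\<alpha>(i := \<alpha> i - 2)) \<xi>)"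
    by (simp only: sum_distrib_left)
  have "X / q * L - 2 * k * (X * m) = X * (L / q - 2 * k * m)" for X q L k m :: real
    by (simp add: algebra_simps)
  then show ?thesis
    unfolding hermite_op_def S vmon_scaleR[of \<alpha>] .
qed

text \<open>For each monomial the contributions k (k + d - 2) of the radial and spherical parts
  cancel, leaving exactly \<open>hermite_op\<close> at the point r \<xi>.\<close>

lemma hyperboloid_operator_polynomial:
  fixes \<xi> :: "real ^ 'd::finite" and c :: "('d \<Rightarrow> nat) \<Rightarrow> real"
  assumes \<rho>: "\<rho> > 0" and t: "\<bar>t\<bar> > \<rho>" and \<xi>: "norm \<xi> = 1" and A: "finite A"
    and u: "\<And>x t. (x, t) \<in> double_hyperboloid \<rho> \<Longrightarrow> u (x, t) = (\<Sum>\<alpha>\<in>A. c \<alpha> * vmon \<alpha> x)"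
  shows "hyperboloid_operator \<rho> u \<xi> t = (\<Sum>\<alpha>\<in>A. c \<alpha> * hermite_op \<alpha> (sqrt (t\<^sup>2 - \<rho>\<^sup>2) *\<^sub>R \<xi>))"
proof -
  define U where "U = hyperboloid_coords \<rho> u"
  have pos: "s\<^sup>2 - \<rho>\<^sup>2 > 0" if "\<bar>s\<bar> > \<rho>" for s
    using power_strict_mono[OF that, of 2] \<rho> by simp
  have pw: "sqrt (s\<^sup>2 - \<rho>\<^sup>2) ^ k = (s\<^sup>2 - \<rho>\<^sup>2) powr (real k / 2)" if "\<bar>s\<bar> > \<rho>" for s k
    using pos[OF that] by (simp add: powr_half_sqrt[symmetric] powr_powr powr_realpow[symmetric])
  have U: "U \<eta> s = (\<Sum>\<alpha>\<in>A. (c \<alpha> * (s\<^sup>2 - \<rho>\<^sup>2) powr (real (sum \<alpha> UNIV) / 2)) * vmon \<alpha> \<eta>)"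
    if "norm \<eta> = 1" "\<bar>s\<bar> > \<rho>" for \<eta> s
  proof -
    have "(sqrt (s\<^sup>2 - \<rho>\<^sup>2) *\<^sub>R \<eta>, s) \<in> double_hyperboloid \<rho>"
      using that pos[OF that(2)] by (simp add: double_hyperboloid_def power_mult_distrib)
    then show ?thesis
      by (simp add: U_def hyperboloid_coords_def u vmon_scaleR pw that mult.assoc del: of_nat_sum)
  qed
  let ?S = "{s. \<bar>s\<bar> > \<rho>}" and ?r = "t\<^sup>2 - \<rho>\<^sup>2"
  let ?a = "\<lambda>\<alpha>::'d \<Rightarrow> nat. real (sum \<alpha> UNIV) / 2"
  let ?D1 = "\<lambda>\<alpha> t. 2 * ?a \<alpha> * t * (t\<^sup>2 - \<rho>\<^sup>2) powr (?a \<alpha> - 1)"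
  let ?D2 = "\<lambda>\<alpha>. 2 * ?a \<alpha> * ?r powr (?a \<alpha> - 1) + 4 * ?a \<alpha> * (?a \<alpha> - 1) * t\<^sup>2 * ?r powr (?a \<alpha> - 2)"
  have S: "open ?S" "t \<in> ?S"
    using t by (auto intro!: open_Collect_less continuous_intros)
  have U\<xi>: "U \<xi> s = (\<Sum>\<alpha>\<in>A. (c \<alpha> * vmon \<alpha> \<xi>) * (s\<^sup>2 - \<rho>\<^sup>2) powr ?a \<alpha>)" if "s \<in> ?S" for s
    using U[OF \<xi>, of s] that by (simp add: mult_ac)
  have d1: "((\<lambda>s. \<Sum>\<alpha>\<in>A. (c \<alpha> * vmon \<alpha> \<xi>) * (s\<^sup>2 - \<rho>\<^sup>2) powr ?a \<alpha>)
      has_field_derivative (\<Sum>\<alpha>\<in>A. (c \<alpha> * vmon \<alpha> \<xi>) * ?D1 \<alpha> s)) (at s)" if "s \<in> ?S" for s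
    using that \<rho> by (intro DERIV_sum DERIV_cmult radial_derivatives) auto
  have d2: "((\<lambda>s. \<Sum>\<alpha>\<in>A. (c \<alpha> * vmon \<alpha> \<xi>) * ?D1 \<alpha> s)
      has_field_derivative (\<Sum>\<alpha>\<in>A. (c \<alpha> * vmon \<alpha> \<xi>) * ?D2 \<alpha>)) (at t)"
    using t \<rho> by (intro DERIV_sum DERIV_cmult radial_derivatives)
  have D1: "deriv (U \<xi>) t = (\<Sum>\<alpha>\<in>A. (c \<alpha> * vmon \<alpha> \<xi>) * ?D1 \<alpha> t)"
    by (rule deriv_eq_on_open(1)[OF S U\<xi> d1 d2])
  have D2: "(deriv ^^ 2) (U \<xi>) t = (\<Sum>\<alpha>\<in>A. (c \<alpha> * vmon \<alpha> \<xi>) * ?D2 \<alpha>)"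
    by (rule deriv_eq_on_open(2)[OF S U\<xi> d1 d2])
  let ?L = "\<lambda>\<alpha>. \<Sum>i\<in>UNIV. real (\<alpha> i) * (real (\<alpha> i) - 1) * vmon (\<alpha>(i := \<alpha> i - 2)) \<xi>"
  have lap: "sphere_laplacian (\<lambda>\<eta>. U \<eta> t) \<xi> = (\<Sum>\<alpha>\<in>A. (c \<alpha> * ?r powr ?a \<alpha>) *
     (?L \<alpha> - real (sum \<alpha> UNIV) * (real (sum \<alpha> UNIV) + real CARD('d) - 2) * vmon \<alpha> \<xi>))"
    by (rule sphere_laplacian_vmon_sum[OF \<xi> A]) (rule U[OF _ t])
  have "hyperboloid_operator \<rho> u \<xi> t = (\<Sum>\<alpha>\<in>A. (c \<alpha> * vmon \<alpha> \<xi>) *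
      ((1 - \<rho>\<^sup>2 / t\<^sup>2) * ?D2 \<alpha> + (\<rho>\<^sup>2 / t\<^sup>2 - 2 * ?r) * (1 / t) * ?D1 \<alpha> t + (real CARD('d) - 1) / t * ?D1 \<alpha> t)
      + 1 / ?r * ((c \<alpha> * ?r powr ?a \<alpha>) *
     (?L \<alpha> - real (sum \<alpha> UNIV) * (real (sum \<alpha> UNIV) + real CARD('d) - 2) * vmon \<alpha> \<xi>)))"
    unfolding hyperboloid_operator_def Let_def U_def[symmetric] D1 D2 lap sum_distrib_left sum.distrib[symmetric]
    by (rule sum.cong[OF refl]) algebra
  also have "\<dots> = (\<Sum>\<alpha>\<in>A. c \<alpha> * hermite_op \<alpha> (sqrt ?r *\<^sub>R \<xi>))"
  proof -
    have collect: "C * m * (k * (k + d - 2) * (X / R) - 2 * k * X) + 1 / R * (C * X * (L - k * (k + d - 2) * m))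
        = C * (X * (L / R - 2 * k * m))" if "R \<noteq> 0" for C m k d X R L :: real
      using that by (simp add: field_simps)
    show ?thesis
    proof (rule sum.cong[OF refl])
      fix \<alpha>
      have "sqrt ?r > 0" "(sqrt ?r)\<^sup>2 = ?r" using pos[OF t] by simp_all
      note h = hermite_op_scaleR[OF this(1), of \<alpha> \<xi>, unfolded this(2), unfolded pw[OF t]]
      have k: "real (sum \<alpha> UNIV) = 2 * ?a \<alpha>" by simp
      show "(c \<alpha> * vmon \<alpha> \<xi>) *
        ((1 - \<rho>\<^sup>2 / t\<^sup>2) * ?D2 \<alpha> + (\<rho>\<^sup>2 / t\<^sup>2 - 2 * ?r) * (1 / t) * ?D1 \<alpha> t + (real CARD('d) - 1) / t * ?D1 \<alpha> t)
        + 1 / ?r * ((c \<alpha> * ?r powr ?a \<alpha>) *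
       (?L \<alpha> - real (sum \<alpha> UNIV) * (real (sum \<alpha> UNIV) + real CARD('d) - 2) * vmon \<alpha> \<xi>))
        = c \<alpha> * hermite_op \<alpha> (sqrt ?r *\<^sub>R \<xi>)"
        unfolding h radial_operator[OF t \<rho> k] using pos[OF t]
        by (intro collect) simp
    qed
  qed
  finally show ?thesis .
qed

section \<open>Reduction to polynomials in x and conclusion\<close>

lemma even_poly_on_hyperboloid:
  fixes p :: "(real ^ 'd::finite) \<times> real \<Rightarrow> real"
  assumes p: "p \<in> polys_deg_le n" and even: "\<And>x t. p (x, - t) = p (x, t)"
  obtains P where "P \<in> polyd n" "\<And>x t. (x, t) \<in> double_hyperboloid \<rho> \<Longrightarrow> p (x, t) = P x"
proof -
  let ?A = "{(\<alpha> :: 'd \<Rightarrow> nat, k :: nat). (\<Sum>i\<in>UNIV. \<alpha> i) + k \<le> n}"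
  obtain c where c: "p = (\<lambda>(x, t). \<Sum>(\<alpha>, k) \<in> ?A. c \<alpha> k * (\<Prod>i\<in>UNIV. (x $ i) ^ \<alpha> i) * t ^ k)"
    using p unfolding polys_deg_le_def by blast
  define T where "T = (\<lambda>(\<alpha>, k) x. if even k
    then c \<alpha> k * (vmon \<alpha> x * ((norm x)\<^sup>2 + \<rho>\<^sup>2) ^ (k div 2)) else 0)"
  define P where "P x = (\<Sum>z\<in>?A. T z x)" for x
  have "P \<in> polyd n"
    unfolding P_def[abs_def]
  proof (rule polyd_sum)
    fix z assume "z \<in> ?A"
    then obtain \<alpha> k where z: "z = (\<alpha>, k)" "sum \<alpha> UNIV + k \<le> n" by auto
    show "T z \<in> polyd n"
    proof (cases "even k")
      case True
      have "(\<lambda>x. vmon \<alpha> x * ((norm x)\<^sup>2 + \<rho>\<^sup>2) ^ (k div 2)) \<in> polyd (sum \<alpha> UNIV + k div 2 * 2)"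
        by (intro polyd_mult polyd_power polyd_add polyd_norm_square polyd_const vmon_in_polyd order_refl)
      then have "(\<lambda>x. c \<alpha> k * (vmon \<alpha> x * ((norm x)\<^sup>2 + \<rho>\<^sup>2) ^ (k div 2))) \<in> polyd n"
        using True z(2) by (intro polyd_cmult) (auto elim!: polyd_mono)
      then show ?thesis using True by (simp add: T_def z(1))
    next
      case False
      then show ?thesis by (simp add: T_def z(1) polyd_zero)
    qed
  qed
  moreover have "p (x, t) = P x" if "(x, t) \<in> double_hyperboloid \<rho>" for x t
  proof -
    have t2: "t\<^sup>2 = (norm x)\<^sup>2 + \<rho>\<^sup>2" using that by (simp add: double_hyperboloid_def)
    \<comment> \<open>Averaging over t and - t removes the odd powers of t without arguing that the
      coefficients of p are unique.\<close>
    have "p (x, t) = (p (x, t) + p (x, - t)) / 2" by (simp add: even)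
    also have "\<dots> = (\<Sum>(\<alpha>, k)\<in>?A. (c \<alpha> k * vmon \<alpha> x * t ^ k + c \<alpha> k * vmon \<alpha> x * (- t) ^ k) / 2)"
      by (simp add: c vmon_def sum.distrib[symmetric] sum_divide_distrib case_prod_unfold)
    also have "\<dots> = P x"
      unfolding P_def
    proof (rule sum.cong[OF refl], clarify)
      fix \<alpha> k
      show "(c \<alpha> k * vmon \<alpha> x * t ^ k + c \<alpha> k * vmon \<alpha> x * (- t) ^ k) / 2 = T (\<alpha>, k) x"
      proof (cases "even k")
        case True
        then have "t ^ k = ((norm x)\<^sup>2 + \<rho>\<^sup>2) ^ (k div 2)"
          by (metis t2 power_mult dvd_mult_div_cancel)
        with True show ?thesis by (simp add: T_def)
      qed (simp add: T_def)
    qed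
    finally show ?thesis .
  qed
  ultimately show thesis by (rule that)
qed

text \<open>Supplies the test functions: orthogonality is given against polynomials in (x, t), while
  the Gaussian argument tests with functions of x alone.\<close>

lemma polyd_imp_polys_deg_le:
  fixes Q :: "real ^ 'd::finite \<Rightarrow> real"
  assumes "Q \<in> polyd m"
  shows "(\<lambda>(x, t). Q x) \<in> polys_deg_le m"
proof -
  let ?A = "{(\<alpha> :: 'd \<Rightarrow> nat, k :: nat). (\<Sum>i\<in>UNIV. \<alpha> i) + k \<le> m}"
  obtain c where c: "Q = (\<lambda>x. \<Sum>\<alpha> | sum \<alpha> UNIV \<le> m. c \<alpha> * vmon \<alpha> x)"
    using assms by (rule polydE)
  define e where "e \<alpha> k = (if k = 0 then c \<alpha> else 0)" for \<alpha> :: "'d \<Rightarrow> nat" and k :: nat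
  have "Q x = (\<Sum>(\<alpha>, k) \<in> ?A. e \<alpha> k * (\<Prod>i\<in>UNIV. (x $ i) ^ \<alpha> i) * t ^ k)" for x t
  proof -
    have "(\<Sum>(\<alpha>, k) \<in> ?A. e \<alpha> k * (\<Prod>i\<in>UNIV. (x $ i) ^ \<alpha> i) * t ^ k) =
        (\<Sum>(\<alpha>, k) \<in> (\<lambda>\<alpha>. (\<alpha>, 0)) ` {\<alpha>. sum \<alpha> UNIV \<le> m}. e \<alpha> k * (\<Prod>i\<in>UNIV. (x $ i) ^ \<alpha> i) * t ^ k)"
      by (rule sum.mono_neutral_right) (auto simp: finite_exponents e_def)
    also have "\<dots> = Q x"
      by (subst sum.reindex) (auto simp: inj_on_def e_def c vmon_def)
    finally show ?thesis by simp
  qed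
  then show ?thesis
    unfolding polys_deg_le_def by (intro CollectI exI[of _ e]) auto
qed

lemma hyperboloid_operator_even_ortho_polys:
  fixes u :: "(real ^ 'd::finite) \<times> real \<Rightarrow> real"
  assumes \<rho>: "\<rho> > 0" and u_ortho: "u \<in> even_ortho_polys \<rho> (w0 \<rho>) n"
    and "\<xi> \<in> sphere 0 1" and t: "\<bar>t\<bar> > \<rho>"
  shows "hyperboloid_operator \<rho> u \<xi> t = - 2 * real n * hyperboloid_coords \<rho> u \<xi> t"
proof -
  have \<xi>: "norm \<xi> = 1" using assms by simp
  obtain p where u: "u = restrict p (double_hyperboloid \<rho>)" and p: "p \<in> polys_deg_le n"
    and even: "\<And>x t. p (x, - t) = p (x, t)"
    and ortho: "\<And>m q. m < n \<Longrightarrow> q \<in> polys_deg_le m \<Longrightarrow> hyperboloid_inner \<rho> (w0 \<rho>) p q = 0"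
    using u_ortho unfolding even_ortho_polys_def by blast
  obtain P where P: "P \<in> polyd n" and pP: "\<And>x t. (x, t) \<in> double_hyperboloid \<rho> \<Longrightarrow> p (x, t) = P x"
    using even_poly_on_hyperboloid[OF p even] by blast
  obtain c where c: "P = (\<lambda>x. \<Sum>\<alpha> | sum \<alpha> UNIV \<le> n. c \<alpha> * vmon \<alpha> x)"
    using P by (rule polydE)
  \<comment> \<open>The factor 2 exp (- \<rho>^2) is nonzero, so a vanishing inner product forces
    the Gaussian integral to vanish.\<close>
  have P_ortho: "gauss_integral (\<lambda>x. P x * Q x) = 0" if "m < n" "Q \<in> polyd m" for m Q
    using hyperboloid_inner_w0[OF \<rho> P that(2) pP, of "\<lambda>(x, t). Q x"]
      ortho[OF that(1) polyd_imp_polys_deg_le[OF that(2)]] by simp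
  let ?x = "sqrt (t\<^sup>2 - \<rho>\<^sup>2) *\<^sub>R \<xi>"
  have "t\<^sup>2 - \<rho>\<^sup>2 > 0" using power_strict_mono[OF t, of 2] \<rho> by simp
  then have mem: "(?x, t) \<in> double_hyperboloid \<rho>"
    using t \<xi> by (simp add: double_hyperboloid_def power_mult_distrib)
  have "hyperboloid_operator \<rho> u \<xi> t = (\<Sum>\<alpha> | sum \<alpha> UNIV \<le> n. c \<alpha> * hermite_op \<alpha> ?x)"
    by (rule hyperboloid_operator_polynomial[OF \<rho> t \<xi> finite_exponents_le])
       (simp add: u pP c)
  also have "\<dots> = - 2 * real n * P ?x"
    unfolding c by (rule hermite_eigenfunction) (use P_ortho in \<open>simp add: c\<close>)
  also have "P ?x = hyperboloid_coords \<rho> u \<xi> t"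
    using mem by (simp add: hyperboloid_coords_def u pP)
  finally show ?thesis .
qed

theorem theorem7p5:
  fixes \<rho> :: real and n :: nat and u :: "(real ^ 'd) \<times> real \<Rightarrow> real"
  assumes "CARD('d) \<ge> 2" and "\<rho> > 0"
    and "u \<in> even_ortho_polys \<rho> (w0 \<rho>) n"
  shows "\<forall>\<xi> \<in> sphere 0 1. \<forall>t. \<bar>t\<bar> > \<rho> \<longrightarrow>
    hyperboloid_operator \<rho> u \<xi> t = - 2 * real n * hyperboloid_coords \<rho> u \<xi> t"
  by (intro ballI allI impI hyperboloid_operator_even_ortho_polys[OF assms(2,3)])

end
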